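(* For every digraph $D$, \[ \xi(D;x,y,z)=\sum_{A,B}x^{k(D\langle A\cup B\rangle)-c(D\langle B\rangle)-c_1(D\langle A\rangle)}\,y^{|A|+|B|-c(D\langle B\rangle)}\,z^{c(D\langle B\rangle)}. \] The sum is over all pairs of arc subsets $A,B\subseteq E(D)$ such that: (1) $A\cap B=\emptyset$; (2) no vertex is incident both to an arc of $A$ and to an arc of $B$; (3) each component of the spanning subgraph $D\langle A\cup B\rangle$ is a directed cycle, a directed path, or an isolated vertex.
   Context: Digraphs are finite directed multigraphs; loops and multiple arcs are allowed. For $F\subseteq E(D)$, $D\langle F\rangle=(V(D),F)$ is the spanning subgraph. $k(H)$ is the number of components of $H$. $c(H)$ is the number of components of $H$ that are not isolated vertices. $c_1(H)$ is the number of loops (cycles of length 1) in $H$. $E_n$ is the arcless digraph on $n$ vertices. The arc operations are as follows. $D_{-e}$ deletes $e$. If $e=(u,v)$ with $u\ne v$, then $D_{/e}$ removes all arcs with tail $u$ and all arcs with head $v$ (including $e$), and then identifies $u$ and $v$ into one new vertex. If $e=(u,u)$ is a loop, then $D_{/e}$ deletes $u$ and its incident arcs. For $e=(u,v)$, $D_{\dagger e}$ deletes $u$, $v$ and all arcs incident to them. The arc elimination polynomial $\xi(D;x,y,z)$ is the (well-defined) digraph invariant given by the following rules: \[ \xi(D)=\xi(D_{-e})+y\,\xi(D_{/e})+z\,\xi(D_{\dagger e}) \text{ for every arc } e, \] \[ \xi(D_1\cup D_2)=\xi(D_1)\xi(D_2),\qquad \xi(E_1)=x,\qquad \xi(E_0)=1.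 \]
   Formalization: Here c_1 counts directed cycles of every length, not only loops; with loops only the identity fails: for two vertices joined by opposite arcs the rules give the term y^2, while the sum with c_1 = number of loops gives x y^2. *)

theory Defs
  imports Main "Graph_Theory.Graph_Theory"
begin

text \<open>
  Finite directed multigraphs (loops and parallel arcs allowed) are the \<^locale>\<open>fin_digraph\<close>s
  of the library.
\<close>

definition arc_contract :: "('a, 'b) pre_digraph \<Rightarrow> 'b \<Rightarrow> ('a, 'b) pre_digraph" where
  "arc_contract D e =
    (let u = tail D e; v = head D e in
     if u = v then pre_digraph.del_vert D u
     else \<lparr> verts = verts D - {v},
            arcs = {a \<in> arcs D. tail D a \<noteq> u \<and> head D a \<noteq> v},
            tail = (\<lambda>a. if tail D a = v then u else tail D a),
            head = (\<lambda>a. if head D a = v then u else head D a) \<rparr>)"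
  \<comment> \<open>The new vertex obtained by identifying \<open>u\<close> and \<open>v\<close> is represented by \<open>u\<close>.\<close>

definition arc_extract :: "('a, 'b) pre_digraph \<Rightarrow> 'b \<Rightarrow> ('a, 'b) pre_digraph" where
  "arc_extract D e = pre_digraph.del_vert (pre_digraph.del_vert D (tail D e)) (head D e)"

text \<open>
  The defining rules of the arc elimination polynomial, for its values at \<open>x, y, z\<close> in a
  commutative ring. The formal polynomial is the case of the generators \<open>x, y, z\<close> of a polynomial
  ring over the integers. \<open>compatible\<close> only says that the two digraphs are given by the same
  tail and head maps; together with isomorphism invariance this is no restriction.
\<close>

definition arc_elimination_invariant ::
  "'r::comm_ring_1 \<Rightarrow> 'r \<Rightarrow> 'r \<Rightarrow> (('a, 'b) pre_digraph \<Rightarrow> 'r) \<Rightarrow> bool" where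
  "arc_elimination_invariant x y z f \<longleftrightarrow>
    (\<forall>D D'. fin_digraph D \<and> fin_digraph D' \<and> digraph_iso D D' \<longrightarrow> f D = f D') \<and>
    (\<forall>D e. fin_digraph D \<and> e \<in> arcs D \<longrightarrow>
       f D = f (pre_digraph.del_arc D e) + y * f (arc_contract D e) + z * f (arc_extract D e)) \<and>
    (\<forall>D1 D2. fin_digraph D1 \<and> fin_digraph D2 \<and> compatible D1 D2 \<and> verts D1 \<inter> verts D2 = {} \<longrightarrow>
       f (union D1 D2) = f D1 * f D2) \<and>
    (\<forall>D v. verts D = {v} \<and> arcs D = {} \<longrightarrow> f D = x) \<and>
    (\<forall>D. verts D = {} \<and> arcs D = {} \<longrightarrow> f D = 1)"

text \<open>
  The rules determine the invariant on all finite digraphs, so there the choice below does not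
  matter.
\<close>

definition arc_elimination ::
  "'r::comm_ring_1 \<Rightarrow> 'r \<Rightarrow> 'r \<Rightarrow> ('a, 'b) pre_digraph \<Rightarrow> 'r" where
  "arc_elimination x y z = (SOME f. arc_elimination_invariant x y z f)"

definition spanning_subgraph :: "('a, 'b) pre_digraph \<Rightarrow> 'b set \<Rightarrow> ('a, 'b) pre_digraph" where
  "spanning_subgraph D F = D \<lparr> arcs := F \<rparr>"

text \<open>\<open>connected\<close> is weak connectedness (and excludes the null digraph).\<close>

definition components :: "('a, 'b) pre_digraph \<Rightarrow> ('a, 'b) pre_digraph set" where
  "components H = {C. pre_digraph.max_subgraph H connected C}"

definition isolated_vertex :: "('a, 'b) pre_digraph \<Rightarrow> bool" where
  "isolated_vertex C \<longleftrightarrow> (\<exists>v. verts C = {v} \<and> arcs C = {})"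

text \<open>Loops and pairs of opposite arcs are directed cycles (of length 1 and 2).\<close>

definition directed_cycle :: "('a, 'b) pre_digraph \<Rightarrow> bool" where
  "directed_cycle C \<longleftrightarrow> (\<exists>u p. pre_digraph.cycle C p \<and>
     arcs C = set p \<and> verts C = set (pre_digraph.awalk_verts C u p))"

definition directed_path :: "('a, 'b) pre_digraph \<Rightarrow> bool" where
  "directed_path C \<longleftrightarrow> (\<exists>u p v. pre_digraph.apath C u p v \<and>
     arcs C = set p \<and> verts C = set (pre_digraph.awalk_verts C u p))"

definition num_components :: "('a, 'b) pre_digraph \<Rightarrow> nat" where
  "num_components H = card (components H)"

definition num_covered_components :: "('a, 'b) pre_digraph \<Rightarrow> nat" where
  "num_covered_components H = card {C \<in> components H. \<not> isolated_vertex C}"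

text \<open>
  The number \<open>c\<^sub>1\<close>: directed cycles of every length are counted, not only those of length 1.
  The source describes \<open>c\<^sub>1\<close> as the number of loops, but the expansion is false with that count:
  for two vertices joined by a pair of opposite arcs the rules give
  \<open>x\<^sup>2 + 2xy + 2z + y\<^sup>2 + yz\<close> (lemma \<open>arc_elimination_invariant_digon\<close>). The term \<open>y\<^sup>2\<close> must be the
  one of \<open>A = arcs D\<close>, \<open>B = {}\<close>, with one component and hence \<open>c\<^sub>1 = 1\<close>, although there is no loop.
  On digraphs all of whose directed cycles are loops the two counts agree.
\<close>

definition num_directed_cycles :: "('a, 'b) pre_digraph \<Rightarrow> nat" where
  "num_directed_cycles H = card {C. subgraph C H \<and> directed_cycle C}"

definition admissible_pairs :: "('a, 'b) pre_digraph \<Rightarrow> ('b set \<times> 'b set) set" where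
  "admissible_pairs D = {(A, B). A \<subseteq> arcs D \<and> B \<subseteq> arcs D \<and>
     A \<inter> B = {} \<and>
     (\<forall>a\<in>A. \<forall>b\<in>B. {tail D a, head D a} \<inter> {tail D b, head D b} = {}) \<and>
     (\<forall>C\<in>components (spanning_subgraph D (A \<union> B)).
        directed_cycle C \<or> directed_path C \<or> isolated_vertex C)}"

text \<open>
  For admissible pairs the exponents in the expansion do not involve truncated subtraction: the
  components of \<open>A \<union> B\<close> include, as distinct ones, the non-trivial components of \<open>B\<close> and the
  directed cycles in \<open>A\<close>, and each non-trivial component of \<open>B\<close> has an arc.
\<close>

lemma arc_elimination_invariant_digon:
  assumes f: "arc_elimination_invariant x y z f"
    and D: "verts D = {u, v}" "u \<noteq> v" "arcs D = {d, e}" "d \<noteq> e"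
      "tail D d = u" "head D d = v" "tail D e = v" "head D e = u"
  shows "f D = x\<^sup>2 + 2 * x * y + 2 * z + y\<^sup>2 + y * z"
proof -
  have rec: "f H = f (pre_digraph.del_arc H a) + y * f (arc_contract H a) + z * f (arc_extract H a)"
    if "fin_digraph H" "a \<in> arcs H" for H a
    using f that unfolding arc_elimination_invariant_def by blast
  have one: "f H = x" if "verts H = {w}" "arcs H = {}" for H w
    using f that unfolding arc_elimination_invariant_def by blast
  have null: "f H = 1" if "verts H = {}" "arcs H = {}" for H
    using f that unfolding arc_elimination_invariant_def by blast
  have two: "f H = x * x" if "verts H = {u, v}" "arcs H = {}" for H
  proof -
    let ?H = "\<lambda>w. H \<lparr> verts := {w} \<rparr>"
    have fin: "fin_digraph (?H w)" for w
      using that by unfold_locales auto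
    have "f (union (?H u) (?H v)) = f (?H u) * f (?H v)"
      using f fin D(2) that unfolding arc_elimination_invariant_def
      by (auto simp: compatible_def)
    moreover have "union (?H u) (?H v) = H"
      using that by (simp add: union_def insert_commute)
    ultimately show ?thesis
      using that by (simp add: one)
  qed
  have dv: "verts (pre_digraph.del_vert H w) = verts H - {w}"
    "arcs (pre_digraph.del_vert H w) = {a \<in> arcs H. tail H a \<noteq> w \<and> head H a \<noteq> w}" for H w
    by (simp_all add: pre_digraph.del_vert_def)
  have loop: "f H = x + y + z"
    if H: "verts H = {w}" "arcs H = {a}" "tail H a = w" "head H a = w" for H w a
  proof -
    have "fin_digraph H" using H by unfold_locales auto
    moreover have "f (pre_digraph.del_arc H a) = x"
      using H by (intro one[of _ w]) (auto simp: pre_digraph.del_arc_def)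
    moreover have "f (arc_contract H a) = 1"
      using H by (intro null) (auto simp: arc_contract_def dv)
    moreover have "f (arc_extract H a) = 1"
      using H by (intro null) (auto simp: arc_extract_def dv)
    ultimately show ?thesis using rec[of H a] H by simp
  qed
  let ?D = "pre_digraph.del_arc D d"
  have D': "verts ?D = {u, v}" "arcs ?D = {e}" "tail ?D e = v" "head ?D e = u"
    using D by (auto simp: pre_digraph.del_arc_def)
  have "fin_digraph D" using D by unfold_locales auto
  moreover have "f (arc_contract D d) = x + y + z"
    using D by (intro loop[of _ u e]) (auto simp: arc_contract_def)
  moreover have "f (arc_extract D d) = 1"
    using D by (intro null) (auto simp: arc_extract_def dv)
  moreover have "f ?D = x * x + y * x + z"
  proof -
    have "fin_digraph ?D" using D' by unfold_locales auto
    moreover have "f (pre_digraph.del_arc ?D e) = x * x"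
      using D' by (intro two) (auto simp: pre_digraph.del_arc_def)
    moreover have "f (arc_contract ?D e) = x"
      using D' D(2) by (intro one[of _ v]) (auto simp: arc_contract_def)
    moreover have "f (arc_extract ?D e) = 1"
      using D' by (intro null) (auto simp: arc_extract_def dv)
    ultimately show ?thesis using rec[of ?D e] D' by simp
  qed
  ultimately show ?thesis
    using rec[of D d] D by (simp add: algebra_simps power2_eq_square)
qed

end

theory Submission
  imports Defs
begin

text \<open>
  In an admissible pair \<open>F = A \<union> B\<close> is an arc set on which tail and head are injective (a linear set),
  and \<open>B\<close> is a union of non-trivial components of \<open>F\<close>. Summing over \<open>B\<close> first turns the expansion into
  the sum over all linear sets \<open>F\<close> of the product of the weights of the components of \<open>(V, F)\<close>, where
  an isolated vertex has weight \<open>x\<close>, and a component with \<open>n > 0\<close> arcs has weight \<open>y\<^sup>n\<^sup>-\<^sup>1 (xy + z)\<close>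
  if it is a path and \<open>y\<^sup>n\<^sup>-\<^sup>1 (y + z)\<close> if it is a cycle. Contracting an arc \<open>e \<in> F\<close> removes one arc and
  one vertex from its component, hence a factor \<open>y\<close>; the exception is a component consisting
  of \<open>e\<close> alone, where the additional summand \<open>z\<close> matches the extraction of \<open>e\<close>.
\<close>

section \<open>Weak components as equivalence classes of vertices\<close>

text \<open>The obstacle is that the exponents speak of maximal connected subgraphs of three
  different spanning subgraphs, while contraction changes the vertex set and both end maps.
  Components are therefore replaced by vertex sets, the classes of a relation on the whole vertex
  type, and all that is remembered of a component is its number of vertices and its number of arcs.
  In a linear digraph these two numbers tell a cycle (equal) from a path (one more vertex), and
  contracting a non-loop arc lowers both by one, so the type is preserved. Walks are needed only to
  translate back to \<open>directed_cycle\<close> and \<open>directed_path\<close>. That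
  \<open>arc_elimination\<close> is well defined is proved on the way: the sum over linear sets
  satisfies all the rules, which gives existence, and induction on the number of arcs gives
  uniqueness. The rule for an arc \<open>e\<close> is checked for each \<open>F\<close> separately,
  so no order of elimination ever enters.\<close>

definition conn :: "('a, 'b) pre_digraph \<Rightarrow> 'a rel" where
  "conn H = ((arcs_ends H)\<^sup>s)\<^sup>*"

text \<open>\<open>conn H\<close> is an equivalence on \<open>UNIV\<close>, in which every point
  that is not an end of an arc is a class of its own. Quotienting \<open>verts H\<close> keeps the
  classes of vertices, isolated ones included.\<close>

definition blocks :: "('a, 'b) pre_digraph \<Rightarrow> 'a set set" where
  "blocks H = verts H // conn H"

text \<open>Testing the tail is enough: arcs join related vertices, so for a block \<open>C\<close>
  the head lies in \<open>C\<close> as well.\<close>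

definition block_arcs :: "('a, 'b) pre_digraph \<Rightarrow> 'a set \<Rightarrow> 'b set" where
  "block_arcs H C = {a \<in> arcs H. tail H a \<in> C}"

definition linear_digraph :: "('a, 'b) pre_digraph \<Rightarrow> bool" where
  "linear_digraph H \<longleftrightarrow> inj_on (tail H) (arcs H) \<and> inj_on (head H) (arcs H)"

text \<open>No arc joins \<open>U\<close> to its complement; among sets of vertices these are the
  unions of blocks.\<close>

definition saturated :: "('a, 'b) pre_digraph \<Rightarrow> 'a set \<Rightarrow> bool" where
  "saturated H U \<longleftrightarrow> (\<forall>a\<in>arcs H. tail H a \<in> U \<longleftrightarrow> head H a \<in> U)"

lemma equiv_conn: "equiv UNIV (conn H)"
proof (rule equivI)
  show "sym (conn H)"
    unfolding conn_def symcl_def by (intro sym_rtrancl) (auto simp: sym_def)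
qed (auto simp: conn_def refl_rtrancl trans_rtrancl)

lemma conn_refl [simp]: "(u, u) \<in> conn H"
  by (simp add: conn_def)

lemma conn_sym: "(u, v) \<in> conn H \<Longrightarrow> (v, u) \<in> conn H"
  using equiv_conn[of H] by (meson equivE symE)

lemma conn_trans: "(u, v) \<in> conn H \<Longrightarrow> (v, w) \<in> conn H \<Longrightarrow> (u, w) \<in> conn H"
  unfolding conn_def by simp

lemma conn_arc: "a \<in> arcs H \<Longrightarrow> (tail H a, head H a) \<in> conn H"
  unfolding conn_def symcl_def arcs_ends_conv by (intro r_into_rtrancl) auto

text \<open>The step is an equivalence, so both directions of the symmetric closure are handled at
  once: a property that is constant along arcs spreads through the whole class.\<close>

lemma conn_induct [consumes 1, case_names refl step]:
  assumes "(u, v) \<in> conn H" "P u"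
    and "\<And>a. a \<in> arcs H \<Longrightarrow> P (tail H a) \<longleftrightarrow> P (head H a)"
  shows "P v"
  using assms(1) unfolding conn_def
  by (induction rule: rtrancl_induct) (use assms(2,3) in \<open>auto simp: symcl_def arcs_ends_conv\<close>)

text \<open>Transport of connectivity along a vertex map that need not be a homomorphism, only send
  the two ends of an arc to related points. It serves for inverses of isomorphisms, for the
  identification of two vertices in a contraction, and, with the identity, for subgraphs.\<close>

lemma conn_map:
  assumes "(u, v) \<in> conn H" "equiv UNIV S"
    and arc: "\<And>a. a \<in> arcs H \<Longrightarrow> (m (tail H a), m (head H a)) \<in> S"
  shows "(m u, m v) \<in> S"
  using assms(1)
proof (induction rule: conn_induct)
  case refl
  show ?case using assms(2) by (meson UNIV_I equivE refl_onD)
next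
  case (step a)
  show ?case using assms(2) arc[OF step] by (meson equivE symE transE)
qed

lemma (in wf_digraph) conn_verts:
  assumes "(u, v) \<in> conn G" "u \<in> verts G"
  shows "v \<in> verts G"
  using assms by (induction rule: conn_induct) auto

lemma (in wf_digraph) block_subset_verts: "C \<in> blocks G \<Longrightarrow> C \<subseteq> verts G"
  by (auto simp: blocks_def quotient_def dest: conn_verts)

lemma block_nonempty: "C \<in> blocks H \<Longrightarrow> C \<noteq> {}"
  unfolding blocks_def by (metis Image_singleton_iff conn_refl empty_iff quotientE)

lemma block_eq_Image: "C \<in> blocks H \<Longrightarrow> u \<in> C \<Longrightarrow> C = conn H `` {u}"
  unfolding blocks_def
  by (metis Image_singleton_iff equiv_class_eq equiv_conn quotientE)

lemma Image_conn_in_blocks: "u \<in> verts H \<Longrightarrow> conn H `` {u} \<in> blocks H"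
  by (auto simp: blocks_def quotient_def)

lemma blocks_disjoint: "C \<in> blocks H \<Longrightarrow> C' \<in> blocks H \<Longrightarrow> u \<in> C \<Longrightarrow> u \<in> C' \<Longrightarrow> C = C'"
  by (metis block_eq_Image)

lemma saturated_block: "C \<in> blocks H \<Longrightarrow> saturated H C"
  unfolding saturated_def blocks_def
  by (metis Image_singleton_iff conn_arc conn_sym conn_trans quotientE)

lemma (in fin_digraph) finite_blocks: "finite (blocks G)"
  by (rule finite_subset[of _ "Pow (verts G)"]) (auto dest: block_subset_verts)

lemma (in fin_digraph) finite_block: "C \<in> blocks G \<Longrightarrow> finite C"
  using block_subset_verts finite_subset finite_verts by blast

section \<open>Induced subgraphs on unions of blocks\<close>

lemma (in wf_digraph) wf_digraph_induce: "wf_digraph (G \<restriction> U)"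
  by unfold_locales (auto simp: induce_subgraph_def)

lemma (in fin_digraph) fin_digraph_induce: "U \<subseteq> verts G \<Longrightarrow> fin_digraph (G \<restriction> U)"
  by unfold_locales (auto simp: induce_subgraph_def intro: finite_subset)

text \<open>An undirected walk that starts in a saturated set never leaves it, so all its arcs are
  arcs of the induced subgraph.\<close>

lemma conn_induce:
  assumes closed: "saturated H U" and "u \<in> U"
  shows "(u, v) \<in> conn (H \<restriction> U) \<longleftrightarrow> (u, v) \<in> conn H"
proof
  assume "(u, v) \<in> conn (H \<restriction> U)"
  then show "(u, v) \<in> conn H"
    by (rule conn_map[OF _ equiv_conn, where m = "\<lambda>x. x", simplified])
      (auto simp: induce_subgraph_def conn_arc)
next
  assume "(u, v) \<in> conn H"
  then have "v \<in> U \<and> (u, v) \<in> conn (H \<restriction> U)"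
  proof (induction rule: conn_induct)
    case refl
    then show ?case using \<open>u \<in> U\<close> by simp
  next
    case (step a)
    have "(tail H a, head H a) \<in> conn (H \<restriction> U)" if "tail H a \<in> U"
      using conn_arc[of a "H \<restriction> U"] step that closed by (simp add: induce_subgraph_def saturated_def)
    then show ?case using closed step unfolding saturated_def by (metis conn_trans conn_sym)
  qed
  then show "(u, v) \<in> conn (H \<restriction> U)" by simp
qed

lemma blocks_induce:
  assumes "saturated H U"
  shows "blocks (H \<restriction> U) = (\<lambda>u. conn H `` {u}) ` U"
  using conn_induce[OF assms] by (auto simp: blocks_def quotient_def)

lemma block_arcs_induce:
  assumes "saturated H U" "C \<subseteq> U"
  shows "block_arcs (H \<restriction> U) C = block_arcs H C"
  using assms by (auto simp: block_arcs_def induce_subgraph_def saturated_def)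

lemma (in wf_digraph) blocks_split:
  assumes closed: "saturated G U" and "U \<subseteq> verts G"
  shows "blocks G = blocks (G \<restriction> U) \<union> blocks (G \<restriction> (verts G - U))"
    and "blocks (G \<restriction> U) \<inter> blocks (G \<restriction> (verts G - U)) = {}"
proof -
  have closed': "saturated G (verts G - U)"
    using closed by (auto simp: saturated_def)
  show "blocks G = blocks (G \<restriction> U) \<union> blocks (G \<restriction> (verts G - U))"
    unfolding blocks_induce[OF closed] blocks_induce[OF closed'] using \<open>U \<subseteq> verts G\<close>
    by (auto simp: blocks_def quotient_def)
  have "\<not> (C \<in> blocks (G \<restriction> U) \<and> C \<in> blocks (G \<restriction> (verts G - U)))" for C
    using wf_digraph.block_subset_verts[OF wf_digraph_induce, of C U]
      wf_digraph.block_subset_verts[OF wf_digraph_induce, of C "verts G - U"]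
      block_nonempty[of C "G \<restriction> U"] by auto
  then show "blocks (G \<restriction> U) \<inter> blocks (G \<restriction> (verts G - U)) = {}" by blast
qed

lemma (in wf_digraph) blocks_induce_block:
  assumes "C \<in> blocks G"
  shows "blocks (G \<restriction> C) = {C}" and "blocks (G \<restriction> (verts G - C)) = blocks G - {C}"
proof -
  note cl = saturated_block[OF assms]
  show *: "blocks (G \<restriction> C) = {C}"
    unfolding blocks_induce[OF cl] using block_nonempty[OF assms]
    by (auto simp flip: block_eq_Image[OF assms])
  show "blocks (G \<restriction> (verts G - C)) = blocks G - {C}"
    using blocks_split[OF cl block_subset_verts[OF assms]] unfolding * by auto
qed

text \<open>For a component with \<open>c\<close> vertices and \<open>n\<close> arcs. If its arcs go
  to \<open>B\<close>, it contributes \<open>y ^ (n - 1) * z\<close>, its factor \<open>x\<close>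
  being cancelled by the count of covered components. If they go to \<open>A\<close>, it contributes
  \<open>y ^ n\<close>, together with \<open>x\<close> for a path; for a cycle the count of directed
  cycles cancels the \<open>x\<close>. In a linear digraph \<open>n = c\<close> recognises the
  cycles.\<close>

definition block_weight :: "'r::comm_ring_1 \<Rightarrow> 'r \<Rightarrow> 'r \<Rightarrow> nat \<Rightarrow> nat \<Rightarrow> 'r" where
  "block_weight x y z c n =
    (if n = 0 then x else y ^ (n - 1) * (z + y * (if n = c then 1 else x)))"

definition weight :: "'r::comm_ring_1 \<Rightarrow> 'r \<Rightarrow> 'r \<Rightarrow> ('a, 'b) pre_digraph \<Rightarrow> 'r" where
  "weight x y z H = (\<Prod>C\<in>blocks H. block_weight x y z (card C) (card (block_arcs H C)))"

lemma (in fin_digraph) weight_split: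
  assumes closed: "saturated G U" and U: "U \<subseteq> verts G"
  shows "weight x y z G = weight x y z (G \<restriction> U) * weight x y z (G \<restriction> (verts G - U))"
proof -
  have closed': "saturated G (verts G - U)"
    using closed by (auto simp: saturated_def)
  have "finite (blocks (G \<restriction> U))" "finite (blocks (G \<restriction> (verts G - U)))"
    using U by (auto intro!: fin_digraph.finite_blocks fin_digraph_induce)
  moreover have "(\<Prod>C\<in>blocks (G \<restriction> W). block_weight x y z (card C) (card (block_arcs G C)))
      = weight x y z (G \<restriction> W)" if "saturated G W" for W
    unfolding weight_def
    using block_arcs_induce[OF that] wf_digraph.block_subset_verts[OF wf_digraph_induce]
    by (intro prod.cong) auto
  ultimately show ?thesis
    unfolding weight_def[of _ _ _ G] blocks_split(1)[OF assms]
    using blocks_split(2)[OF assms] closed closed' by (subst prod.union_disjoint) auto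
qed

lemma (in fin_digraph) weight_block:
  assumes "C \<in> blocks G"
  shows "weight x y z G =
    block_weight x y z (card C) (card (block_arcs G C)) * weight x y z (G \<restriction> (verts G - C))"
proof -
  note cl = saturated_block[OF assms]
  have "weight x y z (G \<restriction> C) = block_weight x y z (card C) (card (block_arcs G C))"
    unfolding weight_def blocks_induce_block[OF assms] using block_arcs_induce[OF cl] by simp
  then show ?thesis
    using weight_split[OF cl block_subset_verts[OF assms], of x y z] by simp
qed

section \<open>Invariance of the weight under isomorphism\<close>

lemma digraph_isomorphism_ends:
  assumes "pre_digraph.digraph_isomorphism H f" "a \<in> arcs H"
  shows "iso_tail f (iso_arcs f a) = iso_verts f (tail H a)"
    "iso_head f (iso_arcs f a) = iso_verts f (head H a)"
  using assms by (auto simp: pre_digraph.digraph_isomorphism_def)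

lemma weight_app_iso:
  assumes f: "pre_digraph.digraph_isomorphism H f"
  shows "weight x y z (app_iso f H) = weight x y z H"
proof -
  interpret wf_digraph H using f by (simp add: pre_digraph.digraph_isomorphism_def)
  let ?v = "iso_verts f" and ?g = "the_inv_into (verts H) (iso_verts f)"
  have inj: "inj_on ?v (verts H)" and inja: "inj_on (iso_arcs f) (arcs H)"
    using f by (auto simp: digraph_isomorphism_def)
  note ends = digraph_isomorphism_ends[OF f]
  have conn: "(?v u, w) \<in> conn (app_iso f H) \<longleftrightarrow> (\<exists>t. w = ?v t \<and> (u, t) \<in> conn H)"
    if u: "u \<in> verts H" for u w
  proof
    assume w: "(?v u, w) \<in> conn (app_iso f H)"
    have wf: "wf_digraph (app_iso f H)"
      using ends by unfold_locales auto
    then have "w \<in> verts (app_iso f H)"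
      using wf_digraph.conn_verts[OF _ w] u by simp
    then obtain t where t: "t \<in> verts H" "w = ?v t" by auto
    \<comment> \<open>The vertex map is injective only on \<open>verts H\<close>, so connectivity is
      pulled back along its inverse there; this needs \<open>w\<close> to be the image of a vertex,
      which was obtained just before.\<close>
    have "(?g (?v u), ?g w) \<in> conn H"
      using w by (rule conn_map[OF _ equiv_conn])
        (auto simp: ends the_inv_into_f_f[OF inj] conn_arc)
    then show "\<exists>t. w = ?v t \<and> (u, t) \<in> conn H"
      using t u by (auto simp: the_inv_into_f_f[OF inj])
  next
    assume "\<exists>t. w = ?v t \<and> (u, t) \<in> conn H"
    then obtain t where t: "w = ?v t" "(u, t) \<in> conn H" by blast
    show "(?v u, w) \<in> conn (app_iso f H)"
      unfolding t(1) using t(2)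
    proof (rule conn_map[OF _ equiv_conn])
      show "(?v (tail H a), ?v (head H a)) \<in> conn (app_iso f H)" if "a \<in> arcs H" for a
        using conn_arc[of "iso_arcs f a" "app_iso f H"] that by (simp add: ends)
    qed
  qed
  have "conn (app_iso f H) `` {?v u} = ?v ` (conn H `` {u})" if "u \<in> verts H" for u
    using conn[OF that] by auto
  then have blocks: "blocks (app_iso f H) = (\<lambda>C. ?v ` C) ` blocks H"
    by (auto simp: blocks_def quotient_def)
  have "inj_on (\<lambda>C. ?v ` C) (blocks H)"
    using block_subset_verts by (intro inj_on_subset[OF inj_on_image_Pow[OF inj]]) auto
  moreover have "card (?v ` C) = card C" if "C \<in> blocks H" for C
    using inj_on_subset[OF inj block_subset_verts[OF that]] by (rule card_image)
  moreover have "card (block_arcs (app_iso f H) (?v ` C)) = card (block_arcs H C)"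
    if "C \<in> blocks H" for C
  proof -
    have "block_arcs (app_iso f H) (?v ` C) = iso_arcs f ` block_arcs H C"
      using inj_on_image_mem_iff[OF inj tail_in_verts block_subset_verts[OF that]]
      unfolding block_arcs_def app_iso_simps by (force simp: ends)
    then show ?thesis
      using inj_on_subset[OF inja, of "block_arcs H C"]
      by (simp add: card_image block_arcs_def)
  qed
  ultimately show ?thesis
    unfolding weight_def blocks by (simp add: prod.reindex)
qed

section \<open>Contraction and extraction in linear digraphs\<close>

lemma arc_extract_eq_induce:
  "wf_digraph D \<Longrightarrow> arc_extract D e = D \<restriction> (verts D - {tail D e, head D e})"
  by (auto simp: arc_extract_def pre_digraph.del_vert_def induce_subgraph_def
      wf_digraph.tail_in_verts wf_digraph.head_in_verts)

text \<open>Extraction deletes both ends of \<open>e\<close>, and deleting the same vertex twice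
  changes nothing more. Hence a loop contributes through \<open>y + z\<close> times a single
  digraph.\<close>

lemma arc_contract_loop: "tail D e = head D e \<Longrightarrow> arc_contract D e = arc_extract D e"
  by (auto simp: Let_def arc_contract_def arc_extract_def pre_digraph.del_vert_def)

lemma fin_digraph_arc_extract: "fin_digraph D \<Longrightarrow> fin_digraph (arc_extract D e)"
  by (simp add: arc_extract_eq_induce fin_digraph.fin_digraph_induce fin_digraph.axioms)

lemma fin_digraph_arc_contract:
  assumes "fin_digraph D" "e \<in> arcs D"
  shows "fin_digraph (arc_contract D e)"
proof (cases "tail D e = head D e")
  case True
  then show ?thesis using assms by (simp add: arc_contract_loop fin_digraph_arc_extract)
next
  case False
  interpret fin_digraph D by fact
  show ?thesis
    using False assms(2) by unfold_locales (auto simp: arc_contract_def Let_def)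
qed

text \<open>The case \<open>u = v\<close> is included: it makes the vertex of a separate loop a
  block.\<close>

lemma (in wf_digraph) pair_block:
  assumes "saturated G {u, v}" "(u, v) \<in> conn G" "u \<in> verts G"
  shows "{u, v} \<in> blocks G"
proof -
  have "w \<in> {u, v}" if "(u, w) \<in> conn G" for w
    using that by (induction rule: conn_induct) (use assms(1) in \<open>auto simp: saturated_def\<close>)
  then have "conn G `` {u} = {u, v}" using assms(2) by auto
  then show ?thesis using Image_conn_in_blocks[OF assms(3)] by simp
qed

text \<open>Linearity means that contraction removes no arc besides \<open>e\<close>. The two
  identified vertices already lie in the same block \<open>C\<close>, so \<open>C\<close> loses one
  vertex and one arc and every other block stays as it is.\<close>

lemma (in fin_digraph) weight_contract_nonloop:
  assumes lin: "linear_digraph G" and e: "e \<in> arcs G" and ne: "tail G e \<noteq> head G e"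
    and C: "C \<in> blocks G" "tail G e \<in> C"
  shows "weight x y z (arc_contract G e) =
    block_weight x y z (card C - 1) (card (block_arcs G C) - 1) *
    weight x y z (G \<restriction> (verts G - C))"
proof -
  define u v G' where "u = tail G e" and "v = head G e" and "G' = arc_contract G e"
  have "u \<noteq> v" "u \<in> C" "u \<in> verts G" "v \<in> verts G"
    using ne C e by (auto simp: u_def v_def)
  have uv: "(u, v) \<in> conn G" unfolding u_def v_def by (rule conn_arc[OF e])
  have "v \<in> C"
    using uv \<open>u \<in> C\<close> block_eq_Image[OF C(1) \<open>u \<in> C\<close>] by simp
  interpret G': fin_digraph G'
    unfolding G'_def using fin_digraph_axioms e by (rule fin_digraph_arc_contract)
  \<comment> \<open>The identification map. Since \<open>m s\<close> and \<open>s\<close> are always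
    connected in \<open>G\<close>, connectivity transfers back by the identity and forward by
    \<open>m\<close>.\<close>
  define m where "m = (\<lambda>s. if s = v then u else s)"
  have verts': "verts G' = verts G - {v}"
    using ne by (simp add: Let_def G'_def arc_contract_def v_def)
  have arcs': "arcs G' = arcs G - {e}"
    using ne lin e by (auto simp: Let_def G'_def arc_contract_def linear_digraph_def dest: inj_onD)
  have tail': "tail G' a = m (tail G a)" and head': "head G' a = m (head G a)" for a
    using ne by (auto simp: Let_def G'_def arc_contract_def m_def u_def v_def)
  have m: "(m s, s) \<in> conn G" for s
    using uv by (simp add: m_def)
  have conn': "conn G' `` {s} = conn G `` {s} - {v}" if s: "s \<in> verts G'" for s
  proof (intro equalityI subsetI)
    fix w assume "w \<in> conn G' `` {s}"
    then have w: "(s, w) \<in> conn G'" by simp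
    have "(tail G' a, head G' a) \<in> conn G" if "a \<in> arcs G'" for a
      using that unfolding arcs' tail' head' by (meson DiffD1 conn_arc conn_sym conn_trans m)
    then have "(s, w) \<in> conn G"
      using conn_map[OF w equiv_conn[of G], of "\<lambda>t. t"] by blast
    moreover have "w \<noteq> v"
      using G'.conn_verts[OF w s] by (simp add: verts')
    ultimately show "w \<in> conn G `` {s} - {v}" by simp
  next
    fix w assume w: "w \<in> conn G `` {s} - {v}"
    have "(m (tail G a), m (head G a)) \<in> conn G'" if "a \<in> arcs G" for a
    proof (cases "a = e")
      case True
      then show ?thesis by (simp add: m_def u_def v_def)
    next
      case False
      then show ?thesis using conn_arc[of a G'] that by (simp add: arcs' tail' head')
    qed
    then have "(m s, m w) \<in> conn G'"
      using w conn_map[OF _ equiv_conn[of G'], of s w G m] by blast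
    then show "w \<in> conn G' `` {s}"
      using w s by (simp add: m_def verts')
  qed
  have Image_v: "conn G `` {v} = conn G `` {u}"
    by (rule equiv_class_eq[OF equiv_conn conn_sym[OF uv]])
  have "verts G = insert v (verts G')" "u \<in> verts G'"
    using \<open>u \<noteq> v\<close> \<open>u \<in> verts G\<close> \<open>v \<in> verts G\<close> by (auto simp: verts')
  then have blocks': "blocks G' = (\<lambda>C. C - {v}) ` blocks G"
    using Image_v conn' by (auto simp: blocks_def quotient_def image_UN)
  have only: "B = C" if "B \<in> blocks G" "v \<in> B \<or> u \<in> B" for B
    using blocks_disjoint[OF that(1) C(1)] that(2) \<open>u \<in> C\<close> \<open>v \<in> C\<close> by blast
  \<comment> \<open>No block becomes empty when \<open>v\<close> is removed, because the block of
    \<open>v\<close> also contains \<open>u\<close>; any remaining vertex identifies the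
    block.\<close>
  have inj: "inj_on (\<lambda>C. C - {v}) (blocks G)"
  proof (rule inj_onI)
    fix B B' assume B: "B \<in> blocks G" "B' \<in> blocks G" "B - {v} = B' - {v}"
    have "\<exists>t\<in>B. t \<noteq> v"
    proof (cases "v \<in> B")
      case True
      then show ?thesis using only[OF B(1)] \<open>u \<in> C\<close> \<open>u \<noteq> v\<close> by blast
    next
      case False
      then show ?thesis using block_nonempty[OF B(1)] by auto
    qed
    then show "B = B'"
      using B blocks_disjoint[OF B(1,2)] by blast
  qed
  have block_arcs': "block_arcs G' (B - {v}) = block_arcs G B - {e}" if "B \<in> blocks G" for B
  proof -
    \<comment> \<open>A block contains both of \<open>u\<close> and \<open>v\<close> or neither, so
      redirecting a tail from \<open>v\<close> to \<open>u\<close> never changes its block.\<close>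
    have "m t \<in> B - {v} \<longleftrightarrow> t \<in> B" for t
      using only[OF that] \<open>u \<in> C\<close> \<open>v \<in> C\<close> \<open>u \<noteq> v\<close> by (auto simp: m_def)
    then show ?thesis by (auto simp: block_arcs_def arcs' tail')
  qed
  have "weight x y z G' =
      (\<Prod>B\<in>blocks G. block_weight x y z (card (B - {v})) (card (block_arcs G B - {e})))"
    unfolding weight_def blocks' using block_arcs' by (simp add: prod.reindex[OF inj])
  also have "\<dots> = block_weight x y z (card (C - {v})) (card (block_arcs G C - {e})) *
      (\<Prod>B\<in>blocks G - {C}. block_weight x y z (card (B - {v})) (card (block_arcs G B - {e})))"
    using C(1) finite_blocks by (simp add: prod.remove)
  also have "card (C - {v}) = card C - 1"
    using \<open>v \<in> C\<close> by simp
  also have "card (block_arcs G C - {e}) = card (block_arcs G C) - 1"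
    using e C(2) by (simp add: block_arcs_def)
  also have "(\<Prod>B\<in>blocks G - {C}. block_weight x y z (card (B - {v})) (card (block_arcs G B - {e})))
      = (\<Prod>B\<in>blocks G - {C}. block_weight x y z (card B) (card (block_arcs (G \<restriction> (verts G - C)) B)))"
  proof (rule prod.cong[OF refl])
    fix B assume B: "B \<in> blocks G - {C}"
    have "e \<notin> block_arcs G B" "v \<notin> B"
      using only[of B] B by (auto simp: block_arcs_def u_def)
    moreover have "B \<subseteq> verts G - C"
      using block_subset_verts[of B] blocks_disjoint[of B G C] B C(1) by blast
    moreover have "saturated G (verts G - C)"
      using saturated_block[OF C(1)] by (simp add: saturated_def)
    ultimately show "block_weight x y z (card (B - {v})) (card (block_arcs G B - {e}))
      = block_weight x y z (card B) (card (block_arcs (G \<restriction> (verts G - C)) B))"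
      by (simp add: block_arcs_induce)
  qed
  also have "\<dots> = weight x y z (G \<restriction> (verts G - C))"
    unfolding weight_def blocks_induce_block(2)[OF C(1)] ..
  finally show ?thesis unfolding G'_def .
qed

text \<open>The elimination rule for a single linear set containing \<open>e\<close>. The extraction
  term is present only if \<open>e\<close> is a component by itself: if another arc meets
  \<open>e\<close>, extraction destroys that arc, and the set has no counterpart there.\<close>

lemma (in fin_digraph) weight_arc_elimination:
  assumes lin: "linear_digraph G" and e: "e \<in> arcs G"
  shows "weight x y z G = y * weight x y z (arc_contract G e) +
    (if \<forall>a\<in>arcs G - {e}. {tail G a, head G a} \<inter> {tail G e, head G e} = {}
     then z * weight x y z (arc_extract G e) else 0)"
proof -
  define u v where "u = tail G e" and "v = head G e"
  have uv: "(u, v) \<in> conn G" "u \<in> verts G" unfolding u_def v_def using conn_arc[OF e] e by auto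
  define C where "C = conn G `` {u}"
  have C: "C \<in> blocks G" "u \<in> C" "v \<in> C"
    using uv by (auto simp: C_def intro: Image_conn_in_blocks)
  define n where "n = card (block_arcs G C)"
  have eC: "e \<in> block_arcs G C"
    using C(2) e by (simp add: block_arcs_def u_def)
  have fin: "finite (block_arcs G C)" by (simp add: block_arcs_def)
  have weight: "weight x y z G = block_weight x y z (card C) n * weight x y z (G \<restriction> (verts G - C))"
    unfolding n_def by (rule weight_block[OF C(1)])
  show ?thesis
  proof (cases "\<forall>a\<in>arcs G - {e}. {tail G a, head G a} \<inter> {tail G e, head G e} = {}")
    case True
    have "tail G a \<in> {u, v} \<longleftrightarrow> head G a \<in> {u, v}" if "a \<in> arcs G" for a
    proof (cases "a = e")
      case False
      then have "{tail G a, head G a} \<inter> {u, v} = {}"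
        using True that unfolding u_def v_def by blast
      then show ?thesis by auto
    qed (simp add: u_def v_def)
    then have "{u, v} \<in> blocks G"
      using uv by (intro pair_block) (auto simp: saturated_def)
    then have Cuv: "C = {u, v}"
      using blocks_disjoint[OF C(1) _ C(2)] by blast
    have "block_arcs G C = {e}"
      using True eC unfolding Cuv block_arcs_def u_def v_def by blast
    then have "n = 1" by (simp add: n_def)
    have ext: "arc_extract G e = G \<restriction> (verts G - C)"
      using arc_extract_eq_induce[OF wf_digraph] by (simp add: Cuv u_def v_def)
    show ?thesis
    proof (cases "u = v")
      case loop: True
      then show ?thesis
        using True weight \<open>n = 1\<close> ext Cuv arc_contract_loop[of G e]
        by (simp add: u_def v_def block_weight_def algebra_simps)
    next
      case False
      then have "weight x y z (arc_contract G e) =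
        block_weight x y z (card C - 1) (n - 1) * weight x y z (G \<restriction> (verts G - C))"
        using weight_contract_nonloop[OF lin e _ C(1), of x y z] C(2)
        by (simp add: n_def u_def v_def)
      then show ?thesis
        using True weight \<open>n = 1\<close> ext Cuv False
        by (simp add: block_weight_def algebra_simps)
    qed
  next
    case False
    then obtain a where a: "a \<in> arcs G" "a \<noteq> e" "{tail G a, head G a} \<inter> {u, v} \<noteq> {}"
      by (auto simp: u_def v_def)
    then have "a \<in> block_arcs G C"
      using saturated_block[OF C(1)] C(2,3) by (auto simp: block_arcs_def saturated_def)
    then have "card {a, e} \<le> n"
      unfolding n_def using fin eC by (intro card_mono) auto
    then have n: "n \<ge> 2" using a(2) by simp
    \<comment> \<open>If \<open>e\<close> were a loop, an arc \<open>a\<close> meeting it would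
      share its tail or its head and hence equal it.\<close>
    have "u \<noteq> v"
      using a lin e by (auto simp: linear_digraph_def u_def v_def dest: inj_onD)
    then have "card {u, v} \<le> card C"
      using C finite_block[OF C(1)] by (intro card_mono) auto
    then have c: "card C \<ge> 2" using \<open>u \<noteq> v\<close> by simp
    have "weight x y z (arc_contract G e) =
        block_weight x y z (card C - 1) (n - 1) * weight x y z (G \<restriction> (verts G - C))"
      using weight_contract_nonloop[OF lin e _ C(1), of x y z] C(2) \<open>u \<noteq> v\<close>
      by (simp add: n_def u_def v_def)
    \<comment> \<open>With at least two arcs the contracted block still has one, so no truncation or
      change of case occurs: the power of \<open>y\<close> drops by one, and
      \<open>n = card C\<close> is equivalent to the same equation with both sides lowered by
      one.\<close>
    moreover obtain k where "n = Suc (Suc k)"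
      using n by (metis Suc_le_D numeral_2_eq_2 Suc_le_mono)
    moreover obtain l where "card C = Suc l"
      using c by (metis Suc_le_D numeral_2_eq_2)
    ultimately show ?thesis
      unfolding weight if_not_P[OF False] by (simp add: block_weight_def mult.assoc)
  qed
qed

section \<open>The sum over linear arc sets\<close>

lemma spanning_subgraph_simps [simp]:
  "verts (spanning_subgraph D F) = verts D" "arcs (spanning_subgraph D F) = F"
  "tail (spanning_subgraph D F) = tail D" "head (spanning_subgraph D F) = head D"
  by (simp_all add: spanning_subgraph_def)

lemma (in wf_digraph) wf_digraph_spanning_subgraph:
  "F \<subseteq> arcs G \<Longrightarrow> wf_digraph (spanning_subgraph G F)"
  by unfold_locales auto

lemma (in fin_digraph) fin_digraph_spanning_subgraph:
  "F \<subseteq> arcs G \<Longrightarrow> fin_digraph (spanning_subgraph G F)"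
  by unfold_locales (auto intro: finite_subset)

definition linear_sets :: "('a, 'b) pre_digraph \<Rightarrow> 'b set set" where
  "linear_sets D = {F. F \<subseteq> arcs D \<and> linear_digraph (spanning_subgraph D F)}"

text \<open>This function is the witness that an arc elimination invariant exists.\<close>

definition linear_expansion :: "'r::comm_ring_1 \<Rightarrow> 'r \<Rightarrow> 'r \<Rightarrow> ('a, 'b) pre_digraph \<Rightarrow> 'r" where
  "linear_expansion x y z D = (\<Sum>F\<in>linear_sets D. weight x y z (spanning_subgraph D F))"

lemma linear_sets_iff:
  "F \<in> linear_sets D \<longleftrightarrow> F \<subseteq> arcs D \<and> inj_on (tail D) F \<and> inj_on (head D) F"
  by (simp add: linear_sets_def linear_digraph_def)

lemma (in fin_digraph) finite_linear_sets: "finite (linear_sets G)"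
  by (rule finite_subset[of _ "Pow (arcs G)"]) (auto simp: linear_sets_iff)

lemma linear_expansion_app_iso:
  assumes f: "pre_digraph.digraph_isomorphism D f"
  shows "linear_expansion x y z (app_iso f D) = linear_expansion x y z D"
proof -
  interpret wf_digraph D using f by (simp add: pre_digraph.digraph_isomorphism_def)
  have injv: "inj_on (iso_verts f) (verts D)" and inj: "inj_on (iso_arcs f) (arcs D)"
    using f by (auto simp: digraph_isomorphism_def)
  note ends = digraph_isomorphism_ends[OF f]
  have lin: "iso_arcs f ` F \<in> linear_sets (app_iso f D) \<longleftrightarrow> F \<in> linear_sets D"
    if F: "F \<subseteq> arcs D" for F
  proof -
    \<comment> \<open>Stated for arbitrary end maps \<open>g\<close> and \<open>h\<close>, so that
      tails and heads are covered by one argument.\<close>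
    have *: "inj_on g (iso_arcs f ` F) \<longleftrightarrow> inj_on h F"
      if "\<And>a. a \<in> arcs D \<Longrightarrow> g (iso_arcs f a) = iso_verts f (h a)" "h ` arcs D \<subseteq> verts D" for g h
    proof -
      have "inj_on g (iso_arcs f ` F) \<longleftrightarrow> inj_on (g \<circ> iso_arcs f) F"
        using inj_on_subset[OF inj F] by (simp add: comp_inj_on_iff)
      also have "\<dots> \<longleftrightarrow> inj_on (iso_verts f \<circ> h) F"
        using F that(1) by (intro inj_on_cong) auto
      also have "\<dots> \<longleftrightarrow> inj_on h F"
        using that(2) F inj_on_subset[OF injv, of "h ` F"]
        by (meson comp_inj_on image_mono inj_on_imageI2 subset_trans)
      finally show ?thesis .
    qed
    show ?thesis
      using F *[of "iso_tail f" "tail D"] *[of "iso_head f" "head D"] ends tail_in_verts head_in_verts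
      by (auto simp: linear_sets_iff image_subset_iff)
  qed
  have "linear_sets (app_iso f D) = (\<lambda>F. iso_arcs f ` F) ` linear_sets D"
  proof (intro equalityI subsetI)
    fix F' assume F': "F' \<in> linear_sets (app_iso f D)"
    then obtain F where "F \<subseteq> arcs D" "F' = iso_arcs f ` F"
      by (auto simp: linear_sets_iff subset_image_iff)
    then show "F' \<in> (\<lambda>F. iso_arcs f ` F) ` linear_sets D" using lin F' by auto
  next
    fix F' assume "F' \<in> (\<lambda>F. iso_arcs f ` F) ` linear_sets D"
    then obtain F where "F \<in> linear_sets D" "F' = iso_arcs f ` F" by blast
    moreover have "F \<subseteq> arcs D" using calculation(1) by (simp add: linear_sets_iff)
    ultimately show "F' \<in> linear_sets (app_iso f D)" using lin by simp
  qed
  moreover have "inj_on (\<lambda>F. iso_arcs f ` F) (linear_sets D)"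
    by (rule inj_on_subset[OF inj_on_image_Pow[OF inj]]) (auto simp: linear_sets_iff)
  moreover have "weight x y z (spanning_subgraph (app_iso f D) (iso_arcs f ` F)) =
      weight x y z (spanning_subgraph D F)" if "F \<in> linear_sets D" for F
  proof -
    have F: "F \<subseteq> arcs D" using that by (simp add: linear_sets_iff)
    have "pre_digraph.digraph_isomorphism (spanning_subgraph D F) f"
      using F injv inj_on_subset[OF inj F] ends wf_digraph_spanning_subgraph[OF F]
      by (auto simp: pre_digraph.digraph_isomorphism_def)
    moreover have "spanning_subgraph (app_iso f D) (iso_arcs f ` F) = app_iso f (spanning_subgraph D F)"
      by (simp add: spanning_subgraph_def app_iso_def)
    ultimately show ?thesis by (metis weight_app_iso)
  qed
  ultimately show ?thesis
    unfolding linear_expansion_def by (simp add: sum.reindex)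
qed

text \<open>Ends of arcs of \<open>D1\<close> and of \<open>D2\<close> lie in disjoint vertex sets,
  so two arcs can clash only inside one of the digraphs.\<close>

lemma linear_sets_union:
  assumes wf: "wf_digraph D1" "wf_digraph D2" and comp: "compatible D1 D2"
    and disj: "verts D1 \<inter> verts D2 = {}" and F: "F1 \<subseteq> arcs D1" "F2 \<subseteq> arcs D2"
  shows "F1 \<union> F2 \<in> linear_sets (union D1 D2) \<longleftrightarrow> F1 \<in> linear_sets D1 \<and> F2 \<in> linear_sets D2"
proof -
  have eq: "tail D2 = tail D1" "head D2 = head D1"
    using comp by (simp_all add: compatible_def)
  have "tail D1 ` F1 \<subseteq> verts D1" "head D1 ` F1 \<subseteq> verts D1"
    using F(1) wf_digraph.wellformed[OF wf(1)] by auto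
  moreover have "tail D1 ` F2 \<subseteq> verts D2" "head D1 ` F2 \<subseteq> verts D2"
    using F(2) wf_digraph.wellformed[OF wf(2)] by (auto simp: eq)
  ultimately have "tail D1 ` (F1 - F2) \<inter> tail D1 ` (F2 - F1) = {}"
    "head D1 ` (F1 - F2) \<inter> head D1 ` (F2 - F1) = {}"
    using disj by blast+
  then show ?thesis
    using F by (auto simp: linear_sets_iff inj_on_Un union_def eq)
qed

lemma linear_expansion_union:
  assumes fin: "fin_digraph D1" "fin_digraph D2" and comp: "compatible D1 D2"
    and disj: "verts D1 \<inter> verts D2 = {}"
  shows "linear_expansion x y z (union D1 D2) =
    linear_expansion x y z D1 * linear_expansion x y z D2"
proof -
  interpret D1: fin_digraph D1 by fact
  interpret D2: fin_digraph D2 by fact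
  let ?U = "union D1 D2"
  have eq: "tail D2 = tail D1" "head D2 = head D1"
    using comp by (simp_all add: compatible_def)
  have U: "verts ?U = verts D1 \<union> verts D2" "arcs ?U = arcs D1 \<union> arcs D2" "tail ?U = tail D1" "head ?U = head D1"
    by (simp_all add: union_def)
  \<comment> \<open>The tail map is common to both digraphs, so a shared arc would have its tail in
    both vertex sets.\<close>
  have disja: "arcs D1 \<inter> arcs D2 = {}"
    using D1.tail_in_verts D2.tail_in_verts disj unfolding eq by (metis disjoint_iff)
  interpret U: fin_digraph ?U
    using D1.wellformed D2.wellformed by unfold_locales (auto simp: U eq)
  note lin = linear_sets_union[OF D1.wf_digraph D2.wf_digraph comp disj]
  have weight: "weight x y z (spanning_subgraph ?U (F1 \<union> F2)) =
      weight x y z (spanning_subgraph D1 F1) * weight x y z (spanning_subgraph D2 F2)"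
    if F: "F1 \<subseteq> arcs D1" "F2 \<subseteq> arcs D2" for F1 F2
  proof -
    have F1: "tail D1 a \<in> verts D1" "head D1 a \<in> verts D1" if "a \<in> F1" for a
      using that F D1.wellformed by auto
    have F2: "tail D1 a \<in> verts D2" "head D1 a \<in> verts D2" if "a \<in> F2" for a
      using that F D2.wellformed unfolding eq by auto
    have F1': "tail D1 a \<notin> verts D2" "head D1 a \<notin> verts D2" if "a \<in> F1" for a
      using F1[OF that] disj by auto
    have F2': "tail D1 a \<notin> verts D1" "head D1 a \<notin> verts D1" if "a \<in> F2" for a
      using F2[OF that] disj by auto
    let ?H = "spanning_subgraph ?U (F1 \<union> F2)"
    interpret H: fin_digraph ?H
      using F by (intro U.fin_digraph_spanning_subgraph) (auto simp: U)
    \<comment> \<open>The two factors of \<open>weight_split\<close> at the saturated set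
      \<open>verts D1\<close> are the two given spanning subgraphs.\<close>
    have "?H \<restriction> verts D1 = spanning_subgraph D1 F1"
      using F1 F2' by (auto simp: induce_subgraph_def U intro!: pre_digraph.equality)
    moreover have "?H \<restriction> (verts ?H - verts D1) = spanning_subgraph D2 F2"
      using F2 F1' F2' F1 disj by (auto simp: induce_subgraph_def U eq intro!: pre_digraph.equality)
    moreover have "saturated ?H (verts D1)"
      using F1 F2' by (auto simp: saturated_def U)
    ultimately show ?thesis
      using H.weight_split[of "verts D1" x y z] by (simp add: U)
  qed
  have "linear_expansion x y z D1 * linear_expansion x y z D2 =
      (\<Sum>(F1, F2)\<in>linear_sets D1 \<times> linear_sets D2.
        weight x y z (spanning_subgraph D1 F1) * weight x y z (spanning_subgraph D2 F2))"
    unfolding linear_expansion_def by (simp add: sum_product sum.cartesian_product)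
  also have "\<dots> = (\<Sum>F\<in>linear_sets ?U. weight x y z (spanning_subgraph ?U F))"
  proof (rule sum.reindex_bij_witness[where i = "\<lambda>F. (F \<inter> arcs D1, F \<inter> arcs D2)" and
        j = "\<lambda>(F1, F2). F1 \<union> F2"], goal_cases)
    case (1 p)
    then obtain F1 F2 where "p = (F1, F2)" "F1 \<subseteq> arcs D1" "F2 \<subseteq> arcs D2"
      by (auto simp: linear_sets_iff)
    moreover have "(F1 \<union> F2) \<inter> arcs D1 = F1" "(F1 \<union> F2) \<inter> arcs D2 = F2"
      using calculation(2,3) disja by blast+
    ultimately show ?case by simp
  next
    case (2 p)
    then obtain F1 F2 where "p = (F1, F2)" "F1 \<in> linear_sets D1" "F2 \<in> linear_sets D2"
      by auto
    moreover have "F1 \<subseteq> arcs D1" "F2 \<subseteq> arcs D2"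
      using calculation(2,3) by (simp_all add: linear_sets_iff)
    ultimately show ?case using lin by simp
  next
    case (3 F)
    then show ?case by (auto simp: linear_sets_iff U)
  next
    case (4 F)
    then have "F = (F \<inter> arcs D1) \<union> (F \<inter> arcs D2)" by (auto simp: linear_sets_iff U)
    then have "F \<inter> arcs D1 \<union> F \<inter> arcs D2 \<in> linear_sets ?U" using 4 by simp
    then show ?case using lin[of "F \<inter> arcs D1" "F \<inter> arcs D2"] by simp
  next
    case (5 p)
    then show ?case using weight by (auto simp: linear_sets_iff)
  qed
  finally show ?thesis unfolding linear_expansion_def[of _ _ _ ?U] by simp
qed

section \<open>Linear sets under contraction and extraction\<close>

lemma arc_contract_simps:
  "arcs (arc_contract D e) = {a \<in> arcs D. tail D a \<noteq> tail D e \<and> head D a \<noteq> head D e}"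
  "tail (arc_contract D e) = (\<lambda>a. if tail D a = head D e then tail D e else tail D a)"
  "head (arc_contract D e) = (\<lambda>a. if head D a = head D e then tail D e else head D a)"
  by (auto simp: arc_contract_def Let_def pre_digraph.del_vert_def)

text \<open>The arcs that survive contraction are those that do not clash with \<open>e\<close> at
  its tail or its head. Among them redirecting tails from the head of \<open>e\<close> to its tail
  creates no new coincidence, since none of them starts at the tail of \<open>e\<close>. For a loop
  the redirection is trivial.\<close>

lemma linear_sets_arc_contract:
  assumes "e \<in> arcs D" "e \<notin> F"
  shows "F \<in> linear_sets (arc_contract D e) \<longleftrightarrow> insert e F \<in> linear_sets D"
proof (cases "\<forall>a\<in>F. tail D a \<noteq> tail D e \<and> head D a \<noteq> head D e")
  case True
  then have "inj_on (tail (arc_contract D e)) F \<longleftrightarrow> inj_on (tail D) F"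
    "inj_on (head (arc_contract D e)) F \<longleftrightarrow> inj_on (head D) F"
    unfolding inj_on_def arc_contract_simps by metis+
  moreover have "inj_on (tail D) (insert e F) \<longleftrightarrow> inj_on (tail D) F"
    "inj_on (head D) (insert e F) \<longleftrightarrow> inj_on (head D) F"
    using True unfolding inj_on_def by (metis insert_iff)+
  moreover have "F \<subseteq> arcs (arc_contract D e) \<longleftrightarrow> insert e F \<subseteq> arcs D"
    using True assms by (auto simp: arc_contract_simps)
  ultimately show ?thesis by (simp add: linear_sets_iff)
next
  case False
  then obtain a where a: "a \<in> F" "tail D a = tail D e \<or> head D a = head D e" by blast
  then have "\<not> F \<subseteq> arcs (arc_contract D e)"
    by (auto simp: arc_contract_simps)
  moreover have "\<not> (inj_on (tail D) (insert e F) \<and> inj_on (head D) (insert e F))"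
    using a assms(2) unfolding inj_on_def by (metis insert_iff)
  ultimately show ?thesis by (simp add: linear_sets_iff)
qed

text \<open>Extraction keeps the end maps and removes every arc that meets \<open>e\<close>, so what
  remains cannot clash with \<open>e\<close>.\<close>

lemma linear_sets_arc_extract:
  assumes "e \<in> arcs D" "e \<notin> F"
  shows "F \<in> linear_sets (arc_extract D e) \<longleftrightarrow>
    insert e F \<in> linear_sets D \<and> (\<forall>a\<in>F. {tail D a, head D a} \<inter> {tail D e, head D e} = {})"
proof (cases "\<forall>a\<in>F. {tail D a, head D a} \<inter> {tail D e, head D e} = {}")
  case True
  then have *: "tail D a \<noteq> tail D e" "tail D a \<noteq> head D e" "head D a \<noteq> tail D e" "head D a \<noteq> head D e"
    if "a \<in> F" for a
    using that by blast+
  have "inj_on (tail D) (insert e F) \<longleftrightarrow> inj_on (tail D) F"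
    "inj_on (head D) (insert e F) \<longleftrightarrow> inj_on (head D) F"
    using * unfolding inj_on_def by (metis insert_iff)+
  moreover have "F \<subseteq> arcs (arc_extract D e) \<longleftrightarrow> insert e F \<subseteq> arcs D"
    using * assms(1) by (auto simp: arc_extract_def pre_digraph.del_vert_def)
  moreover have "tail (arc_extract D e) = tail D" "head (arc_extract D e) = head D"
    by (simp_all add: arc_extract_def pre_digraph.del_vert_def)
  ultimately show ?thesis unfolding linear_sets_iff using True by simp
next
  case False
  then have "\<not> F \<subseteq> arcs (arc_extract D e)"
    by (auto simp: arc_extract_def pre_digraph.del_vert_def)
  then show ?thesis unfolding linear_sets_iff using False by blast
qed

text \<open>Linear sets that avoid \<open>e\<close> are those of the deletion. Removing
  \<open>e\<close> from the others gives a bijection with the linear sets of the contraction, and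
  its restriction to the sets \<open>?S\<close>, in which \<open>e\<close> is separate, is a
  bijection with those of the extraction.\<close>

lemma linear_expansion_arc_elimination:
  fixes D :: "('a, 'b) pre_digraph" and x y z :: "'r::comm_ring_1"
  assumes fin: "fin_digraph D" and e: "e \<in> arcs D"
  shows "linear_expansion x y z D = linear_expansion x y z (pre_digraph.del_arc D e)
    + y * linear_expansion x y z (arc_contract D e) + z * linear_expansion x y z (arc_extract D e)"
proof -
  interpret fin_digraph D by fact
  let ?w = "\<lambda>F. weight x y z (spanning_subgraph D F)"
  let ?L = "{F \<in> linear_sets D. e \<in> F}"
  let ?S = "{F \<in> ?L. \<forall>a\<in>F - {e}. {tail D a, head D a} \<inter> {tail D e, head D e} = {}}"
  have finL: "finite ?L" using finite_linear_sets by simp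
  have "linear_expansion x y z (pre_digraph.del_arc D e) = (\<Sum>F\<in>{F \<in> linear_sets D. e \<notin> F}. ?w F)"
    unfolding linear_expansion_def
    by (intro sum.cong arg_cong[where f = "weight x y z"])
      (auto simp: linear_sets_iff spanning_subgraph_def del_arc_def)
  moreover have "linear_expansion x y z D = (\<Sum>F\<in>{F \<in> linear_sets D. e \<notin> F}. ?w F) + (\<Sum>F\<in>?L. ?w F)"
    unfolding linear_expansion_def using finite_linear_sets
    by (subst sum.union_disjoint[symmetric]) (auto intro!: sum.cong)
  moreover have "(\<Sum>F\<in>?L. ?w F) = y * linear_expansion x y z (arc_contract D e)
      + z * linear_expansion x y z (arc_extract D e)"
  proof -
    \<comment> \<open>Contracting and restricting to \<open>F\<close> commute because by linearity
      no arc of \<open>F\<close> other than \<open>e\<close> is lost in the contraction.\<close>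
    have con: "spanning_subgraph (arc_contract D e) (F - {e}) = arc_contract (spanning_subgraph D F) e"
      if "F \<in> ?L" for F
    proof -
      have "tail D a \<noteq> tail D e" "head D a \<noteq> head D e" if "a \<in> F - {e}" for a
        using that \<open>F \<in> ?L\<close> by (auto simp: linear_sets_iff dest: inj_onD)
      then show ?thesis
        by (auto simp: arc_contract_def Let_def spanning_subgraph_def pre_digraph.del_vert_def)
    qed
    have ext: "spanning_subgraph (arc_extract D e) (F - {e}) = arc_extract (spanning_subgraph D F) e"
      if "F \<in> ?S" for F
    proof -
      have "tail D a \<noteq> tail D e" "tail D a \<noteq> head D e" "head D a \<noteq> tail D e" "head D a \<noteq> head D e"
        if "a \<in> F - {e}" for a
        using that \<open>F \<in> ?S\<close> by blast+
      then show ?thesis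
        by (auto simp: arc_extract_def spanning_subgraph_def pre_digraph.del_vert_def)
    qed
    have "?w F = y * weight x y z (spanning_subgraph (arc_contract D e) (F - {e})) +
        (if F \<in> ?S then z * weight x y z (spanning_subgraph (arc_extract D e) (F - {e})) else 0)"
      if "F \<in> ?L" for F
    proof -
      have F: "F \<subseteq> arcs D" "linear_digraph (spanning_subgraph D F)" "e \<in> F"
        using that by (auto simp: linear_sets_def)
      interpret F: fin_digraph "spanning_subgraph D F"
        using F(1) by (rule fin_digraph_spanning_subgraph)
      show ?thesis
        using F.weight_arc_elimination[OF F(2), of e x y z] F(3) that con[OF that] ext[of F] by auto
    qed
    moreover have "(\<Sum>F\<in>?L. if F \<in> ?S then g F else 0) = (\<Sum>F\<in>?S. g F)"
      for g :: "'b set \<Rightarrow> 'r"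
    proof -
      have "?L \<inter> ?S = ?S" by blast
      then show ?thesis using sum.inter_restrict[OF finL, of g ?S] by simp
    qed
    ultimately have "(\<Sum>F\<in>?L. ?w F) =
        y * (\<Sum>F\<in>?L. weight x y z (spanning_subgraph (arc_contract D e) (F - {e})))
        + z * (\<Sum>F\<in>?S. weight x y z (spanning_subgraph (arc_extract D e) (F - {e})))"
      by (simp only: sum.distrib sum_distrib_left cong: sum.cong)
    moreover have "(\<Sum>F\<in>?L. weight x y z (spanning_subgraph (arc_contract D e) (F - {e})))
        = linear_expansion x y z (arc_contract D e)"
    proof -
      have "e \<notin> F" if "F \<in> linear_sets (arc_contract D e)" for F
        using that by (auto simp: linear_sets_iff arc_contract_simps)
      then have "F \<in> linear_sets (arc_contract D e) \<longleftrightarrow> e \<notin> F \<and> insert e F \<in> linear_sets D" for F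
        using linear_sets_arc_contract[OF e] by blast
      then show ?thesis
        unfolding linear_expansion_def
        by (intro sum.reindex_bij_witness[where i = "insert e" and j = "\<lambda>F. F - {e}"])
          (simp_all add: insert_absorb)
    qed
    moreover have "(\<Sum>F\<in>?S. weight x y z (spanning_subgraph (arc_extract D e) (F - {e})))
        = linear_expansion x y z (arc_extract D e)"
    proof -
      have "e \<notin> F" if "F \<in> linear_sets (arc_extract D e)" for F
        using that by (auto simp: linear_sets_iff arc_extract_def pre_digraph.del_vert_def)
      then have "F \<in> linear_sets (arc_extract D e) \<longleftrightarrow> e \<notin> F \<and> insert e F \<in> linear_sets D \<and>
        (\<forall>a\<in>F. {tail D a, head D a} \<inter> {tail D e, head D e} = {})" for F
        using linear_sets_arc_extract[OF e] by blast
      then show ?thesis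
        unfolding linear_expansion_def
        by (intro sum.reindex_bij_witness[where i = "insert e" and j = "\<lambda>F. F - {e}"])
          (simp_all add: insert_absorb)
    qed
    ultimately show ?thesis by simp
  qed
  ultimately show ?thesis by (simp add: add.assoc)
qed

section \<open>Existence and uniqueness of the arc elimination invariant\<close>

lemma linear_expansion_arcless:
  assumes "arcs D = {}"
  shows "linear_expansion x y z D = x ^ card (verts D)"
proof -
  have [simp]: "linear_sets D = {{}}" "spanning_subgraph D {} = D"
    using assms by (auto simp: linear_sets_iff spanning_subgraph_def)
  have "(u, v) \<in> conn D \<longleftrightarrow> u = v" for u v
    using assms by (auto simp: conn_def arcs_ends_conv symcl_def)
  then have "blocks D = (\<lambda>v. {v}) ` verts D"
    by (auto simp: blocks_def quotient_def)
  then show ?thesis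
    using assms
    by (simp add: linear_expansion_def weight_def block_arcs_def block_weight_def card_image)
qed

lemma arc_elimination_invariant_linear_expansion:
  "arc_elimination_invariant x y z (linear_expansion x y z)"
  unfolding arc_elimination_invariant_def digraph_iso_def
  by (auto simp: linear_expansion_app_iso linear_expansion_arc_elimination linear_expansion_union
      linear_expansion_arcless)

text \<open>Deletion, contraction and extraction all remove at least \<open>e\<close>, so the rules
  reduce every value to arcless digraphs, where the union rule forces a power of
  \<open>x\<close>.\<close>

lemma arc_elimination_invariant_unique:
  assumes f: "arc_elimination_invariant x y z f" and g: "arc_elimination_invariant x y z g"
    and "fin_digraph D"
  shows "f D = g D"
  using assms(3)
proof (induction "card (arcs D)" arbitrary: D rule: less_induct)
  case less
  interpret fin_digraph D by fact
  have rec: "h D = h (del_arc e) + y * h (arc_contract D e) + z * h (arc_extract D e)"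
    if "arc_elimination_invariant x y z h" "e \<in> arcs D" for h e
    using that less.prems unfolding arc_elimination_invariant_def by blast
  show ?case
  proof (cases "arcs D = {}")
    case True
    have "h D = x ^ card (verts D)" if h: "arc_elimination_invariant x y z h" for h
    proof -
      \<comment> \<open>Only the vertex set varies while the end maps of \<open>D\<close> are kept,
        so the pieces are \<open>compatible\<close> and the union rule applies to them.\<close>
      have "h (D\<lparr>verts := V\<rparr>) = x ^ card V" if "finite V" for V
        using that
      proof (induction V)
        case empty
        then show ?case using h True by (simp add: arc_elimination_invariant_def)
      next
        case (insert v V)
        have fin: "fin_digraph (D\<lparr>verts := W\<rparr>)" if "finite W" for W
          using True that by unfold_locales auto
        have "union (D\<lparr>verts := {v}\<rparr>) (D\<lparr>verts := V\<rparr>) = D\<lparr>verts := insert v V\<rparr>"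
          by (simp add: union_def)
        moreover have "h (union (D\<lparr>verts := {v}\<rparr>) (D\<lparr>verts := V\<rparr>)) =
            h (D\<lparr>verts := {v}\<rparr>) * h (D\<lparr>verts := V\<rparr>)"
          using h fin[of "{v}"] fin[of V] insert.hyps unfolding arc_elimination_invariant_def
          by (simp add: compatible_def)
        moreover have "h (D\<lparr>verts := {v}\<rparr>) = x"
          using h True unfolding arc_elimination_invariant_def by simp
        ultimately have "h (D\<lparr>verts := insert v V\<rparr>) = x * h (D\<lparr>verts := V\<rparr>)" by metis
        then show ?case using insert by simp
      qed
      from this[OF finite_verts] show ?thesis by simp
    qed
    from this[OF f] this[OF g] show ?thesis by simp
  next
    case False
    then obtain e where e: "e \<in> arcs D" by blast
    have "arcs (del_arc e) \<subset> arcs D" "arcs (arc_contract D e) \<subset> arcs D" "arcs (arc_extract D e) \<subset> arcs D"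
      using e by (auto simp: arc_contract_def arc_extract_def Let_def pre_digraph.del_vert_def)
    then have "card (arcs (del_arc e)) < card (arcs D)"
      "card (arcs (arc_contract D e)) < card (arcs D)" "card (arcs (arc_extract D e)) < card (arcs D)"
      by (auto intro!: psubset_card_mono)
    moreover have "fin_digraph (del_arc e)"
      by unfold_locales auto
    ultimately show ?thesis
      using less.hyps[of "del_arc e"] less.hyps[of "arc_contract D e"] less.hyps[of "arc_extract D e"]
        fin_digraph_arc_contract[OF less.prems e] fin_digraph_arc_extract[OF less.prems]
        rec[OF f e] rec[OF g e] by simp
  qed
qed

text \<open>The chosen function need not be \<open>linear_expansion\<close> itself, since the rules
  say nothing about infinite digraphs; on finite ones uniqueness makes them agree.\<close>

theorem arc_elimination_eq_linear_expansion:
  "fin_digraph D \<Longrightarrow> arc_elimination x y z D = linear_expansion x y z D"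
  unfolding arc_elimination_def
  using arc_elimination_invariant_linear_expansion[of x y z]
    arc_elimination_invariant_unique[of x y z _ "linear_expansion x y z" D]
  by (metis someI)

section \<open>Components of linear digraphs\<close>

text \<open>\<open>connected\<close> is based on a closure restricted to the vertices. As all ends
  of arcs are vertices, a walk between two vertices cannot leave them, so the unrestricted closure
  \<open>conn\<close> gives the same.\<close>

lemma (in wf_digraph) connected_iff_conn:
  "connected G \<longleftrightarrow> verts G \<noteq> {} \<and> (\<forall>u\<in>verts G. \<forall>v\<in>verts G. (u, v) \<in> conn G)"
proof -
  have "(u, v) \<in> rtrancl_on (verts G) ((arcs_ends G)\<^sup>s) \<longleftrightarrow> (u, v) \<in> conn G"
    if "u \<in> verts G" "v \<in> verts G" for u v
  proof
    show "(u, v) \<in> conn G" if "(u, v) \<in> rtrancl_on (verts G) ((arcs_ends G)\<^sup>s)"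
      using rtrancl_on_rtranclI[OF that] by (simp add: conn_def)
    show "(u, v) \<in> rtrancl_on (verts G) ((arcs_ends G)\<^sup>s)" if "(u, v) \<in> conn G"
      using that \<open>u \<in> verts G\<close> \<open>v \<in> verts G\<close> unfolding conn_def
      by (rule rtrancl_consistent_rtrancl_on) (auto simp: symcl_def arcs_ends_conv)
  qed
  then show ?thesis by (auto simp: connected_conv)
qed

lemma conn_subgraph:
  assumes "subgraph K H" "(u, v) \<in> conn K"
  shows "(u, v) \<in> conn H"
proof -
  have "(tail K a, head K a) \<in> conn H" if "a \<in> arcs K" for a
    using that assms(1) conn_arc[of a H] by (auto simp: subgraph_def compatible_def)
  then show ?thesis
    using conn_map[OF assms(2) equiv_conn[of H], of "\<lambda>t. t"] by blast
qed

lemma (in wf_digraph) subgraph_induce: "U \<subseteq> verts G \<Longrightarrow> subgraph (G \<restriction> U) G"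
  using wf_digraph_induce wf_digraph
  by (auto simp: subgraph_def compatible_def induce_subgraph_def)

lemma arcs_induce_block: "C \<in> blocks H \<Longrightarrow> arcs (H \<restriction> C) = block_arcs H C"
  using saturated_block[of C H] by (auto simp: saturated_def block_arcs_def induce_subgraph_def)

lemma conn_within_block: "C \<in> blocks H \<Longrightarrow> u \<in> C \<Longrightarrow> v \<in> C \<Longrightarrow> (u, v) \<in> conn H"
  using block_eq_Image[of C H u] by auto

lemma conn_induce_block:
  "C \<in> blocks H \<Longrightarrow> u \<in> C \<Longrightarrow> v \<in> C \<Longrightarrow> (u, v) \<in> conn (H \<restriction> C)"
  using conn_induce[OF saturated_block, of C H u v] conn_within_block[of C H u v] by simp

text \<open>A connected subgraph lies inside a single block, and the subgraph induced by a block is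
  itself connected; so maximality leaves exactly the induced ones.\<close>

lemma (in wf_digraph) components_eq: "components G = (\<lambda>C. G \<restriction> C) ` blocks G"
proof (intro equalityI subsetI)
  fix K assume "K \<in> components G"
  then have K: "subgraph K G" "connected K"
    and max: "\<And>K'. subgraph K K' \<Longrightarrow> subgraph K' G \<Longrightarrow> connected K' \<Longrightarrow> K' = K"
    by (auto simp: components_def max_subgraph_def)
  have wfK: "wf_digraph K" using K by (auto simp: subgraph_def)
  obtain u where u: "u \<in> verts K"
    using K(2) wf_digraph.connected_iff_conn[OF wfK] by blast
  define C where "C = conn G `` {u}"
  have C: "C \<in> blocks G"
    using K(1) u unfolding C_def by (intro Image_conn_in_blocks) (auto simp: subgraph_def)
  have sub: "verts K \<subseteq> C"
    using K(2) u conn_subgraph[OF K(1)] unfolding wf_digraph.connected_iff_conn[OF wfK] C_def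
    by auto
  have "subgraph K (G \<restriction> C)"
    unfolding subgraph_def
  proof (intro conjI)
    show "arcs K \<subseteq> arcs (G \<restriction> C)"
      using K(1) sub wf_digraph.wellformed[OF wfK]
      by (fastforce simp: subgraph_def compatible_def induce_subgraph_def)
  qed (use sub K(1) wfK wf_digraph_induce in \<open>auto simp: subgraph_def compatible_def induce_subgraph_def\<close>)
  moreover have "connected (G \<restriction> C)"
    using block_nonempty[OF C] conn_induce_block[OF C]
    by (simp add: wf_digraph.connected_iff_conn[OF wf_digraph_induce])
  ultimately have "G \<restriction> C = K"
    using max subgraph_induce[OF block_subset_verts[OF C]] by blast
  then show "K \<in> (\<lambda>C. G \<restriction> C) ` blocks G" using C by blast
next
  fix K assume "K \<in> (\<lambda>C. G \<restriction> C) ` blocks G"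
  then obtain C where C: "C \<in> blocks G" "K = G \<restriction> C" by blast
  have "connected K"
    using block_nonempty[OF C(1)] conn_induce_block[OF C(1)]
    by (simp add: wf_digraph.connected_iff_conn[OF wf_digraph_induce] C(2))
  moreover have "subgraph K G"
    using subgraph_induce[OF block_subset_verts[OF C(1)]] by (simp add: C(2))
  moreover have "K' = K" if K': "subgraph K K'" "subgraph K' G" "connected K'" for K'
  proof -
    have wf: "wf_digraph K'" using K' by (simp add: subgraph_def)
    obtain u where u: "u \<in> C" using block_nonempty[OF C(1)] by blast
    then have "u \<in> verts K'" using K'(1) by (auto simp: subgraph_def C(2))
    then have "verts K' \<subseteq> C"
      using K'(3) conn_subgraph[OF K'(2)] block_eq_Image[OF C(1) u]
      unfolding wf_digraph.connected_iff_conn[OF wf] by auto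
    then have "verts K' = C" using K'(1) by (auto simp: subgraph_def C(2))
    moreover have "arcs K' \<subseteq> arcs K"
    proof
      fix a assume "a \<in> arcs K'"
      moreover from this have "tail K' a \<in> C" "head K' a \<in> C"
        using wf_digraph.wellformed[OF wf] \<open>verts K' = C\<close> by auto
      ultimately show "a \<in> arcs K"
        using K'(2) by (auto simp: subgraph_def compatible_def C(2) induce_subgraph_def)
    qed
    moreover have "arcs K \<subseteq> arcs K'" "tail K' = tail K" "head K' = head K"
      using K'(1) by (auto simp: subgraph_def compatible_def)
    ultimately show "K' = K"
      using C(2) by (intro pre_digraph.equality) auto
  qed
  ultimately show "K \<in> components G"
    by (auto simp: components_def max_subgraph_def)
qed

lemma inj_on_induce: "inj_on (\<lambda>C. H \<restriction> C) X"
  by (rule inj_onI) (metis induce_subgraph_verts)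

lemma (in wf_digraph) num_components_eq: "num_components G = card (blocks G)"
  unfolding num_components_def components_eq by (simp add: card_image inj_on_induce)

text \<open>Without arcs the relation reaches nothing but the starting vertex, so a block with no
  arcs has just one vertex.\<close>

lemma isolated_vertex_induce_block:
  assumes C: "C \<in> blocks H"
  shows "isolated_vertex (H \<restriction> C) \<longleftrightarrow> block_arcs H C = {}"
proof
  assume arcs: "block_arcs H C = {}"
  obtain u where u: "u \<in> C" using block_nonempty[OF C] by blast
  have "w = u" if "w \<in> C" for w
    using conn_induce_block[OF C u that]
  proof (induction rule: conn_induct)
    case (step a)
    then show ?case unfolding arcs_induce_block[OF C] arcs by blast
  qed simp
  then have "C = {u}" using u by blast
  then show "isolated_vertex (H \<restriction> C)"
    using arcs arcs_induce_block[OF C] by (auto simp: isolated_vertex_def)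
qed (use arcs_induce_block[OF C] in \<open>auto simp: isolated_vertex_def\<close>)

definition nontrivial_blocks :: "('a, 'b) pre_digraph \<Rightarrow> 'a set set" where
  "nontrivial_blocks H = {C \<in> blocks H. block_arcs H C \<noteq> {}}"

lemma (in wf_digraph) num_covered_components_eq:
  "num_covered_components G = card (nontrivial_blocks G)"
proof -
  have "{K \<in> components G. \<not> isolated_vertex K} = (\<lambda>C. G \<restriction> C) ` nontrivial_blocks G"
    unfolding components_eq nontrivial_blocks_def using isolated_vertex_induce_block by blast
  then show ?thesis
    unfolding num_covered_components_def by (simp add: card_image inj_on_induce)
qed

section \<open>Ends of arcs along directed cycles and paths\<close>

context wf_digraph
begin

lemma set_awalk_verts_tail: "cas u p v \<Longrightarrow> set (awalk_verts u p) = insert v (tail G ` set p)"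
  by (induction u p v rule: cas.induct) auto

lemma set_awalk_verts_head: "cas u p v \<Longrightarrow> set (awalk_verts u p) = insert u (head G ` set p)"
proof (induction u p v rule: cas.induct)
  case (2 u e es v)
  then show ?case by auto
qed simp

lemma cas_conn:
  "cas u p v \<Longrightarrow> set p \<subseteq> arcs G \<Longrightarrow> w \<in> set (awalk_verts u p) \<Longrightarrow> (u, w) \<in> conn G"
proof (induction u p v rule: cas.induct)
  case (2 u e es v)
  then show ?case using conn_arc[of e G] by (auto intro: conn_trans)
qed simp

text \<open>The distinctness condition in \<open>cycle\<close> concerns all visited vertices but the
  first, that is, the heads. Injectivity of the tail map follows by counting.\<close>

lemma directed_cycle_structure:
  assumes "directed_cycle G"
  shows "inj_on (tail G) (arcs G)" "inj_on (head G) (arcs G)"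
    "tail G ` arcs G = verts G" "head G ` arcs G = verts G"
    "card (arcs G) = card (verts G)" "verts G \<noteq> {}"
    "\<exists>u\<in>verts G. \<forall>w\<in>verts G. (u, w) \<in> conn G"
proof -
  obtain u w p where p: "awalk u p u" "distinct (tl (awalk_verts u p))" "p \<noteq> []"
    and arcs: "arcs G = set p" and verts: "verts G = set (awalk_verts w p)"
    using assms by (auto simp: directed_cycle_def cycle_def)
  \<comment> \<open>\<open>directed_cycle\<close> does not tie its starting point to the closed
    walk, but for a nonempty arc list the visited vertices do not depend on it.\<close>
  have verts: "verts G = set (awalk_verts u p)"
    using verts awalk_verts_ne_eq[OF p(3), of w u] by simp
  have cas: "cas u p u" using p(1) by (simp add: awalk_def)
  have "tl (awalk_verts u p) = map (head G) p"
    using awalk_verts_conv'[OF cas] p(3) by simp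
  then have dist: "distinct (map (head G) p)" using p(2) by simp
  then show injh: "inj_on (head G) (arcs G)" by (simp add: distinct_map arcs)
  have "u \<in> tail G ` set p"
    using cas p(3) by (cases p) auto
  then show t: "tail G ` arcs G = verts G"
    using set_awalk_verts_tail[OF cas] by (auto simp: verts arcs)
  have "u = awlast u p" using awlast_if_cas[OF cas] by simp
  then have "u \<in> head G ` set p"
    using p(3) by (simp add: awalk_verts_conv)
  then show h: "head G ` arcs G = verts G"
    using set_awalk_verts_head[OF cas] by (auto simp: verts arcs)
  show card: "card (arcs G) = card (verts G)"
    using card_image[OF injh] h by simp
  have "finite (arcs G)" by (simp add: arcs)
  \<comment> \<open>The tails exhaust the vertices and there are as many arcs as vertices, so no
    tail repeats.\<close>
  then show "inj_on (tail G) (arcs G)"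
    using card t by (simp add: eq_card_imp_inj_on)
  show "verts G \<noteq> {}" by (simp add: verts)
  show "\<exists>u\<in>verts G. \<forall>w\<in>verts G. (u, w) \<in> conn G"
    using cas_conn[OF cas] p(1) unfolding verts awalk_def
    by (intro bexI[of _ u]) (auto simp: set_awalk_verts_head[OF cas])
qed

lemma directed_path_structure:
  assumes "directed_path G"
  shows "inj_on (tail G) (arcs G)" "inj_on (head G) (arcs G)"
proof -
  obtain u p v where p: "awalk u p v" "distinct (awalk_verts u p)" and arcs: "arcs G = set p"
    using assms by (auto simp: directed_path_def apath_def)
  have cas: "cas u p v" using p(1) by (simp add: awalk_def)
  have "distinct (map (tail G) p)"
    using p(2) awalk_verts_conv[of u p] by (auto split: if_splits)
  moreover have "distinct (map (head G) p)"
    using p(2) awalk_verts_conv'[OF cas] by (auto split: if_splits)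
  ultimately show "inj_on (tail G) (arcs G)" "inj_on (head G) (arcs G)"
    by (simp_all add: distinct_map arcs)
qed

text \<open>Used to show that a cycle or a maximal path exhausts a connected digraph: it is enough
  that no arc leaves or enters its vertex set.\<close>

lemma saturated_eq_verts:
  assumes "\<And>u v. u \<in> verts G \<Longrightarrow> v \<in> verts G \<Longrightarrow> (u, v) \<in> conn G"
    and "saturated G S" "u \<in> S" "S \<subseteq> verts G"
  shows "S = verts G"
proof -
  have "v \<in> S" if "v \<in> verts G" for v
  proof -
    have "(u, v) \<in> conn G" using assms that by blast
    then show ?thesis
      by (induction rule: conn_induct) (use assms(2,3) in \<open>auto simp: saturated_def\<close>)
  qed
  then show ?thesis using assms(4) by blast
qed

end

text \<open>A path that cannot be extended either closes up to a cycle or is everything.\<close>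

lemma (in fin_digraph) linear_connected_cases:
  assumes lin: "linear_digraph G" and ne: "verts G \<noteq> {}"
    and con: "\<And>u v. u \<in> verts G \<Longrightarrow> v \<in> verts G \<Longrightarrow> (u, v) \<in> conn G"
  shows "directed_cycle G \<and> card (arcs G) = card (verts G) \<or>
    directed_path G \<and> card (verts G) = Suc (card (arcs G))"
proof -
  have injt: "a = b" if "a \<in> arcs G" "b \<in> arcs G" "tail G a = tail G b" for a b
    using lin that by (auto simp: linear_digraph_def dest: inj_onD)
  have injh: "a = b" if "a \<in> arcs G" "b \<in> arcs G" "head G a = head G b" for a b
    using lin that by (auto simp: linear_digraph_def dest: inj_onD)
  \<comment> \<open>Lengths of paths without repeated vertices. They are bounded by the number of
    vertices, so a longest such path exists.\<close>
  define P where "P n \<longleftrightarrow> (\<exists>u p v. apath u p v \<and> length p = n)" for n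
  have "P 0"
    using ne by (auto simp: P_def apath_def awalk_def)
  moreover have bound: "n \<le> card (verts G)" if n: "P n" for n
  proof -
    obtain u p v where p: "apath u p v" "length p = n" using n by (auto simp: P_def)
    have "Suc n = card (set (awalk_verts u p))"
      using p distinct_card[of "awalk_verts u p"] by (simp add: apath_def length_awalk_verts)
    also have "\<dots> \<le> card (verts G)"
      using p(1) unfolding apath_def awalk_conv by (intro card_mono finite_verts) blast
    finally show ?thesis by simp
  qed
  ultimately obtain n where "P n" and max: "\<And>m. P m \<Longrightarrow> m \<le> n"
    by (metis GreatestI_nat Greatest_le_nat)
  then obtain u p v where p: "awalk u p v" "distinct (awalk_verts u p)" "length p = n"
    unfolding P_def apath_def by blast
  have cas: "cas u p v" and parcs: "set p \<subseteq> arcs G" and uv: "u \<in> verts G" "v \<in> verts G"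
    using p(1) awlast_in_verts[of u p] awlast_if_cas[of u p v] by (simp_all add: awalk_def)
  define S where "S = set (awalk_verts u p)"
  have S: "S = insert v (tail G ` set p)" "S = insert u (head G ` set p)"
    using set_awalk_verts_tail[OF cas] set_awalk_verts_head[OF cas] by (simp_all add: S_def)
  have SG: "S \<subseteq> verts G" using uv parcs by (auto simp: S(1))
  have wt: "awalk_verts u p = map (tail G) p @ [v]"
    using awalk_verts_conv[of u p] awlast_if_cas[OF cas] by (auto split: if_splits)
  have wh: "awalk_verts u p = u # map (head G) p"
    using awalk_verts_conv'[OF cas] cas by (cases p) auto
  have dt: "distinct (map (tail G) p)" "v \<notin> tail G ` set p"
    using p(2) unfolding wt by auto
  have dh: "distinct (map (head G) p)" "u \<notin> head G ` set p"
    using p(2) unfolding wh by auto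
  have dp: "distinct p" using dt(1) by (simp add: distinct_map)
  show ?thesis
  \<comment> \<open>Does some arc lead from the end of the longest path back to its start? For a
    path of length 0 such an arc is a loop.\<close>
  proof (cases "\<exists>a\<in>arcs G. tail G a = v \<and> head G a = u")
    case True
    then obtain a where a: "a \<in> arcs G" "tail G a = v" "head G a = u" by blast
    let ?q = "p @ [a]"
    have "a \<notin> set p" using dt(2) a(2) by auto
    have q: "distinct ?q" "set ?q \<subseteq> arcs G" "cas u ?q u"
      using dp \<open>a \<notin> set p\<close> parcs a cas awlast_if_cas[OF cas] by auto
    have Sq: "S = tail G ` set ?q" "S = head G ` set ?q"
      using S a by auto
    \<comment> \<open>Every vertex of the closed walk is already the tail of one of its arcs and the
      head of another or the same one, so injectivity leaves no room for further arcs there.\<close>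
    have in_q: "b \<in> set ?q" if "b \<in> arcs G" "tail G b \<in> S \<or> head G b \<in> S" for b
    proof -
      have "tail G b \<in> tail G ` set ?q \<or> head G b \<in> head G ` set ?q"
        using that(2) Sq by simp
      then obtain c where "c \<in> set ?q" "tail G b = tail G c \<or> head G b = head G c"
        by blast
      then show ?thesis
        using injt[OF that(1), of c] injh[OF that(1), of c] q(2) by blast
    qed
    have "saturated G S"
      unfolding saturated_def using in_q Sq by blast
    moreover have "u \<in> S" by (simp add: S(2))
    ultimately have SV: "S = verts G"
      using saturated_eq_verts[of S u] con SG by simp
    then have arcs: "arcs G = set ?q"
      using in_q q(2) tail_in_verts by blast
    have "inj_on (head G) (arcs G)" using lin by (simp add: linear_digraph_def)
    then have "distinct (map (head G) ?q)" and card: "card (arcs G) = card (verts G)"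
      using q(1) Sq(2) SV card_image[of "head G" "arcs G"] by (simp_all add: distinct_map arcs)
    moreover have "awalk_verts u ?q = u # map (head G) ?q"
      using awalk_verts_conv'[OF q(3)] q(3) by (cases p) auto
    ultimately have "cycle ?q" and "verts G = set (awalk_verts u ?q)"
      unfolding cycle_def using q uv S SV a(3) by (auto simp: awalk_def simp del: map_append)
    then have "directed_cycle G"
      using arcs unfolding directed_cycle_def by blast
    then show ?thesis using card by simp
  next
    case False
    \<comment> \<open>An arc leaving \<open>v\<close> would extend the path if its head were new.
      Otherwise its head is not \<open>u\<close> by the case assumption, so it is the head of a path
      arc; by injectivity it is that arc, whose tail cannot be \<open>v\<close>.\<close>
    have v: "tail G a \<noteq> v" if a: "a \<in> arcs G" for a
    proof
      assume t: "tail G a = v"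
      have "head G a \<in> S"
      proof (rule ccontr)
        assume "head G a \<notin> S"
        moreover have "awalk_verts u (p @ [a]) = awalk_verts u p @ [head G a]"
          using t by (simp add: awalk_verts_conv[of u "p @ [a]"] wt)
        ultimately have "apath u (p @ [a]) (head G a)"
          using p(1,2) a t awlast_if_cas[OF cas] unfolding apath_def awalk_def S_def by auto
        then have "P (Suc n)" using p(3) unfolding P_def by force
        then show False using max by fastforce
      qed
      then have "head G a \<in> head G ` set p"
        using False a t unfolding S(2) by auto
      then have "a \<in> set p" using injh[OF a] parcs by auto
      then show False using dt(2) t by auto
    qed
    \<comment> \<open>The mirror image, prepending the arc; that the tail differs from
      \<open>v\<close> is now known from the previous fact.\<close>
    have u: "head G a \<noteq> u" if a: "a \<in> arcs G" for a
    proof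
      assume h: "head G a = u"
      have "tail G a \<in> S"
      proof (rule ccontr)
        assume "tail G a \<notin> S"
        then have "apath (tail G a) (a # p) v"
          using p(1,2) a h unfolding apath_def awalk_def S_def by auto
        then have "P (Suc n)" using p(3) unfolding P_def by force
        then show False using max by fastforce
      qed
      then have "tail G a \<in> tail G ` set p"
        using v[OF a] unfolding S(1) by auto
      then have "a \<in> set p" using injt[OF a] parcs by auto
      then show False using dh(2) h by auto
    qed
    have in_p: "b \<in> set p" if b: "b \<in> arcs G" "tail G b \<in> S \<or> head G b \<in> S" for b
    proof -
      have "tail G b \<in> tail G ` set p \<or> head G b \<in> head G ` set p"
        using b S u v by (metis insertE)
      then obtain c where "c \<in> set p" "tail G b = tail G c \<or> head G b = head G c"
        by blast
      then show ?thesis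
        using injt[OF b(1), of c] injh[OF b(1), of c] parcs by blast
    qed
    have "saturated G S"
      unfolding saturated_def using in_p S by blast
    moreover have "u \<in> S" by (simp add: S(2))
    ultimately have SV: "S = verts G"
      using saturated_eq_verts[of S u] con SG by simp
    then have arcs: "arcs G = set p"
      using in_p parcs tail_in_verts by blast
    have "directed_path G"
      using p arcs SV unfolding directed_path_def apath_def S_def by blast
    moreover have "card (verts G) = Suc (card (arcs G))"
      using distinct_card[OF p(2)] distinct_card[OF dp]
      by (simp add: SV[symmetric] S_def arcs length_awalk_verts)
    ultimately show ?thesis by simp
  qed
qed

lemma linear_digraph_subset:
  "linear_digraph H \<Longrightarrow> arcs K \<subseteq> arcs H \<Longrightarrow> tail K = tail H \<Longrightarrow> head K = head H \<Longrightarrow> linear_digraph K"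
  unfolding linear_digraph_def by (metis inj_on_subset)

lemma (in fin_digraph) linear_block_cases:
  assumes lin: "linear_digraph G" and C: "C \<in> blocks G"
  shows "directed_cycle (G \<restriction> C) \<and> card (block_arcs G C) = card C \<or>
    directed_path (G \<restriction> C) \<and> card C = Suc (card (block_arcs G C))"
proof -
  interpret K: fin_digraph "G \<restriction> C"
    using block_subset_verts[OF C] by (rule fin_digraph_induce)
  have "linear_digraph (G \<restriction> C)"
    using lin by (rule linear_digraph_subset) (auto simp: induce_subgraph_def)
  then show ?thesis
    using K.linear_connected_cases block_nonempty[OF C] conn_induce_block[OF C]
    by (simp add: arcs_induce_block[OF C] del: induce_subgraph_arcs)
qed

text \<open>Two arcs with a common tail or a common head belong to the same component, so
  injectivity of the end maps can be tested component by component.\<close>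

lemma (in fin_digraph) linear_iff_components:
  "linear_digraph G \<longleftrightarrow>
    (\<forall>K\<in>components G. directed_cycle K \<or> directed_path K \<or> isolated_vertex K)"
proof
  assume "linear_digraph G"
  then show "\<forall>K\<in>components G. directed_cycle K \<or> directed_path K \<or> isolated_vertex K"
    using linear_block_cases unfolding components_eq by blast
next
  assume comps: "\<forall>K\<in>components G. directed_cycle K \<or> directed_path K \<or> isolated_vertex K"
  have inj: "inj_on (tail G) (block_arcs G C)" "inj_on (head G) (block_arcs G C)"
    if C: "C \<in> blocks G" for C
  proof -
    interpret K: wf_digraph "G \<restriction> C" by (rule wf_digraph_induce)
    have "directed_cycle (G \<restriction> C) \<or> directed_path (G \<restriction> C) \<or> block_arcs G C = {}"
      using comps C isolated_vertex_induce_block[OF C] unfolding components_eq by blast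
    then have "inj_on (tail (G \<restriction> C)) (arcs (G \<restriction> C)) \<and> inj_on (head (G \<restriction> C)) (arcs (G \<restriction> C))"
    proof (elim disjE)
      assume "block_arcs G C = {}"
      then show ?thesis unfolding arcs_induce_block[OF C] by simp
    qed (blast intro: K.directed_cycle_structure(1,2) K.directed_path_structure)+
    then show "inj_on (tail G) (block_arcs G C)" "inj_on (head G) (block_arcs G C)"
      unfolding arcs_induce_block[OF C] by (simp_all add: induce_subgraph_def)
  qed
  have same: "\<exists>C\<in>blocks G. a \<in> block_arcs G C \<and> b \<in> block_arcs G C"
    if "a \<in> arcs G" "b \<in> arcs G" "tail G a = tail G b \<or> head G a = head G b" for a b
  proof -
    let ?C = "conn G `` {tail G a}"
    have C: "?C \<in> blocks G" using that(1) by (intro Image_conn_in_blocks) simp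
    have "tail G a \<in> ?C" by simp
    then have "head G a \<in> ?C" using saturated_block[OF C] that(1) unfolding saturated_def by blast
    then have "tail G b \<in> ?C"
      using that \<open>tail G a \<in> ?C\<close> saturated_block[OF C] unfolding saturated_def by metis
    then show ?thesis using C that \<open>tail G a \<in> ?C\<close> unfolding block_arcs_def by blast
  qed
  show "linear_digraph G"
    unfolding linear_digraph_def inj_on_def
  proof (intro conjI ballI impI)
    fix a b assume "a \<in> arcs G" "b \<in> arcs G" "tail G a = tail G b"
    then show "a = b" using same inj(1) by (meson inj_onD)
  next
    fix a b assume "a \<in> arcs G" "b \<in> arcs G" "head G a = head G b"
    then show "a = b" using same inj(2) by (meson inj_onD)
  qed
qed

text \<open>In a linear digraph a directed cycle is a whole component: each of its vertices has its
  only incoming and its only outgoing arc on the cycle. Blocks with as many arcs as vertices are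
  cycles because paths have one vertex more.\<close>

lemma (in fin_digraph) num_directed_cycles_eq:
  assumes lin: "linear_digraph G"
  shows "num_directed_cycles G = card {C \<in> blocks G. card (block_arcs G C) = card C}"
proof -
  have "{K. subgraph K G \<and> directed_cycle K}
      = (\<lambda>C. G \<restriction> C) ` {C \<in> blocks G. card (block_arcs G C) = card C}"
  proof (intro equalityI subsetI)
    fix K assume "K \<in> {K. subgraph K G \<and> directed_cycle K}"
    then have sub: "subgraph K G" and cyc: "directed_cycle K" by auto
    interpret K: wf_digraph K using sub by (simp add: subgraph_def)
    have K: "verts K \<subseteq> verts G" "arcs K \<subseteq> arcs G" "tail K = tail G" "head K = head G"
      using sub by (auto simp: subgraph_def compatible_def)
    note str = K.directed_cycle_structure[OF cyc]
    have in_K: "a \<in> arcs K" if a: "a \<in> arcs G" "tail G a \<in> verts K \<or> head G a \<in> verts K" for a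
    proof -
      have "tail G a \<in> tail G ` arcs K \<or> head G a \<in> head G ` arcs K"
        using a(2) str(3,4) by (simp add: K)
      then show ?thesis
        using lin a(1) K(2) unfolding linear_digraph_def by (meson inj_on_image_mem_iff)
    qed
    have sat: "saturated G (verts K)"
      using in_K K.wellformed unfolding saturated_def K(3,4) by blast
    obtain u where u: "u \<in> verts K" "\<forall>w\<in>verts K. (u, w) \<in> conn K"
      using str(7) by blast
    have "w \<in> verts K" if "(u, w) \<in> conn G" for w
      using that by (induction rule: conn_induct) (use sat u(1) in \<open>auto simp: saturated_def\<close>)
    then have "verts K = conn G `` {u}"
      using u conn_subgraph[OF sub] by blast
    then have C: "verts K \<in> blocks G"
      using Image_conn_in_blocks[of u G] subsetD[OF K(1) u(1)] by simp
    have arcs: "arcs K = block_arcs G (verts K)"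
      using in_K K(2) K.tail_in_verts unfolding block_arcs_def K(3) by blast
    then have "K = G \<restriction> verts K"
      using arcs_induce_block[OF C] K(3,4) by (intro pre_digraph.equality) (auto simp: induce_subgraph_def)
    then show "K \<in> (\<lambda>C. G \<restriction> C) ` {C \<in> blocks G. card (block_arcs G C) = card C}"
      using C str(5) arcs by (metis (mono_tags, lifting) image_eqI mem_Collect_eq)
  next
    fix K assume "K \<in> (\<lambda>C. G \<restriction> C) ` {C \<in> blocks G. card (block_arcs G C) = card C}"
    then obtain C where C: "C \<in> blocks G" "card (block_arcs G C) = card C" "K = G \<restriction> C" by auto
    then show "K \<in> {K. subgraph K G \<and> directed_cycle K}"
      using linear_block_cases[OF lin C(1)] subgraph_induce[OF block_subset_verts[OF C(1)]] by auto
  qed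
  then show ?thesis
    unfolding num_directed_cycles_def by (simp add: card_image inj_on_induce)
qed

text \<open>\<open>F\<close> takes from each block all arcs or none. A block taken whole keeps its
  arcs and its connectivity, so it remains a block. Conversely, a class with an arc \<open>a\<close>
  shares the tail of \<open>a\<close> with the block of \<open>a\<close> in \<open>G\<close>, which
  was taken whole, and so coincides with it.\<close>

lemma (in wf_digraph) nontrivial_blocks_spanning_subgraph:
  assumes F: "F \<subseteq> arcs G"
    and whole: "\<And>C. C \<in> blocks G \<Longrightarrow> block_arcs G C \<inter> F \<noteq> {} \<Longrightarrow> block_arcs G C \<subseteq> F"
  shows "nontrivial_blocks (spanning_subgraph G F) = {C \<in> nontrivial_blocks G. block_arcs G C \<subseteq> F}"
    and "C \<in> nontrivial_blocks (spanning_subgraph G F) \<Longrightarrow>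
      block_arcs (spanning_subgraph G F) C = block_arcs G C"
proof -
  let ?H = "spanning_subgraph G F"
  have block: "C \<in> blocks ?H" "block_arcs ?H C = block_arcs G C"
    if C: "C \<in> blocks G" "block_arcs G C \<subseteq> F" for C
  proof -
    have sat: "saturated ?H C"
      using saturated_block[OF C(1)] F by (auto simp: saturated_def)
    show "block_arcs ?H C = block_arcs G C"
      using C(2) F by (auto simp: block_arcs_def)
    have "G \<restriction> C = ?H \<restriction> C"
      using C F by (auto simp: induce_subgraph_def block_arcs_def)
    then have conn: "(u, v) \<in> conn ?H \<longleftrightarrow> (u, v) \<in> conn G" if "u \<in> C" for u v
      using conn_induce[OF sat that] conn_induce[OF saturated_block[OF C(1)] that] by simp
    obtain u where u: "u \<in> C" using block_nonempty[OF C(1)] by blast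
    have "C = conn ?H `` {u}"
      using block_eq_Image[OF C(1) u] conn[OF u] by auto
    then show "C \<in> blocks ?H"
      using Image_conn_in_blocks[of u ?H] subsetD[OF block_subset_verts[OF C(1)] u] by simp
  qed
  have conversely: "C \<in> blocks G" "block_arcs G C \<subseteq> F" "block_arcs G C \<noteq> {}"
    if C: "C \<in> nontrivial_blocks ?H" for C
  proof -
    obtain a where a: "a \<in> F" "tail G a \<in> C"
      using C by (auto simp: nontrivial_blocks_def block_arcs_def)
    let ?C = "conn G `` {tail G a}"
    have C': "?C \<in> blocks G" using a F by (intro Image_conn_in_blocks) auto
    have "a \<in> block_arcs G ?C" using a F by (auto simp: block_arcs_def)
    then have *: "block_arcs G ?C \<subseteq> F" "block_arcs G ?C \<noteq> {}"
      using whole[OF C'] a(1) by blast+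
    have "?C = C"
      using blocks_disjoint[OF block(1)[OF C' *(1)], of C "tail G a"] C a(2)
      by (simp add: nontrivial_blocks_def)
    then show "C \<in> blocks G" "block_arcs G C \<subseteq> F" "block_arcs G C \<noteq> {}"
      using C' * by simp_all
  qed
  show "nontrivial_blocks ?H = {C \<in> nontrivial_blocks G. block_arcs G C \<subseteq> F}"
  proof (intro equalityI subsetI)
    fix C assume "C \<in> nontrivial_blocks ?H"
    from conversely[OF this] show "C \<in> {C \<in> nontrivial_blocks G. block_arcs G C \<subseteq> F}"
      by (simp add: nontrivial_blocks_def)
  next
    fix C assume "C \<in> {C \<in> nontrivial_blocks G. block_arcs G C \<subseteq> F}"
    then show "C \<in> nontrivial_blocks ?H" using block[of C] by (auto simp: nontrivial_blocks_def)
  qed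
  show "block_arcs ?H C = block_arcs G C" if "C \<in> nontrivial_blocks ?H"
    using block(2) conversely[OF that] by blast
qed

lemma block_arcs_disjoint:
  "C \<in> blocks H \<Longrightarrow> C' \<in> blocks H \<Longrightarrow> a \<in> block_arcs H C \<Longrightarrow> a \<in> block_arcs H C' \<Longrightarrow> C = C'"
  unfolding block_arcs_def using blocks_disjoint[of C H C' "tail H a"] by simp

lemma (in wf_digraph) arcs_eq_Union_block_arcs: "arcs G = (\<Union>C\<in>nontrivial_blocks G. block_arcs G C)"
proof -
  have "\<exists>C\<in>nontrivial_blocks G. a \<in> block_arcs G C" if a: "a \<in> arcs G" for a
  proof -
    have "a \<in> block_arcs G (conn G `` {tail G a})" "conn G `` {tail G a} \<in> blocks G"
      using a Image_conn_in_blocks[of "tail G a" G] by (auto simp: block_arcs_def)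
    then show ?thesis unfolding nontrivial_blocks_def by blast
  qed
  moreover have "block_arcs G C \<subseteq> arcs G" for C by (auto simp: block_arcs_def)
  ultimately show ?thesis by blast
qed

section \<open>Expanding the product over the components\<close>

text \<open>\<open>X\<close> is the set of components whose arcs form \<open>B\<close>. What is left
  in the exponent of \<open>x\<close> are the isolated vertices and the paths among the components
  of \<open>A\<close>, and each component in \<open>X\<close> loses one factor
  \<open>y\<close>.\<close>

lemma (in fin_digraph) admissible_summand_eq_prod:
  fixes x y z :: "'r::comm_ring_1"
  assumes lin: "linear_digraph G" and X: "X \<subseteq> nontrivial_blocks G"
  defines "B \<equiv> \<Union>C\<in>X. block_arcs G C" and "A \<equiv> \<Union>C\<in>nontrivial_blocks G - X. block_arcs G C"
  shows "x ^ (num_components G - num_covered_components (spanning_subgraph G B)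
            - num_directed_cycles (spanning_subgraph G A))
       * y ^ (card A + card B - num_covered_components (spanning_subgraph G B))
       * z ^ num_covered_components (spanning_subgraph G B) =
    x ^ card (blocks G - nontrivial_blocks G) *
    ((\<Prod>C\<in>X. y ^ (card (block_arcs G C) - 1) * z) *
     (\<Prod>C\<in>nontrivial_blocks G - X.
        y ^ card (block_arcs G C) * (if card (block_arcs G C) = card C then 1 else x)))"
proof -
  let ?N = "nontrivial_blocks G" and ?n = "\<lambda>C. card (block_arcs G C)"
  have N: "?N \<subseteq> blocks G" by (auto simp: nontrivial_blocks_def)
  have fin: "finite (blocks G)" "finite ?N" "finite X" "finite (?N - X)"
    using finite_blocks N X by (auto intro: finite_subset)
  have fina: "finite (block_arcs G C)" for C by (simp add: block_arcs_def)
  have part: "nontrivial_blocks (spanning_subgraph G (\<Union>C\<in>Y. block_arcs G C)) = Y"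
      "\<And>C. C \<in> Y \<Longrightarrow> block_arcs (spanning_subgraph G (\<Union>C\<in>Y. block_arcs G C)) C = block_arcs G C"
      "(\<Union>C\<in>Y. block_arcs G C) \<subseteq> arcs G"
      "card (\<Union>C\<in>Y. block_arcs G C) = (\<Sum>C\<in>Y. ?n C)"
    if Y: "Y \<subseteq> ?N" for Y
  proof -
    let ?F = "\<Union>C\<in>Y. block_arcs G C"
    show F: "?F \<subseteq> arcs G" by (auto simp: block_arcs_def)
    have meet: "C \<in> Y" if "C \<in> blocks G" "block_arcs G C \<inter> ?F \<noteq> {}" for C
      using that Y N block_arcs_disjoint[of C G] by blast
    have whole: "block_arcs G C \<subseteq> ?F" if "C \<in> blocks G" "block_arcs G C \<inter> ?F \<noteq> {}" for C
      using meet[OF that] by blast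
    note * = nontrivial_blocks_spanning_subgraph[OF F whole]
    show **: "nontrivial_blocks (spanning_subgraph G ?F) = Y"
    proof -
      have "C \<in> Y" if "C \<in> ?N" "block_arcs G C \<subseteq> ?F" for C
        using that meet[of C] unfolding nontrivial_blocks_def by blast
      then show ?thesis using Y by (subst *(1)) auto
    qed
    show "block_arcs (spanning_subgraph G ?F) C = block_arcs G C" if "C \<in> Y" for C
      using *(2)[of C] that unfolding ** by blast
    show "card ?F = (\<Sum>C\<in>Y. ?n C)"
    proof (intro card_UN_disjoint ballI impI)
      show "finite Y" using Y fin(2) by (rule finite_subset)
      show "block_arcs G C \<inter> block_arcs G C' = {}" if "C \<in> Y" "C' \<in> Y" "C \<noteq> C'" for C C'
        using block_arcs_disjoint[of C G C'] that Y N by blast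
    qed (rule fina)
  qed
  have A: "A \<subseteq> arcs G" and B: "B \<subseteq> arcs G"
    using part(3)[OF X] part(3)[of "?N - X"] by (auto simp: A_def B_def)
  interpret HA: fin_digraph "spanning_subgraph G A" using A by (rule fin_digraph_spanning_subgraph)
  interpret HB: fin_digraph "spanning_subgraph G B" using B by (rule fin_digraph_spanning_subgraph)
  have cov: "num_covered_components (spanning_subgraph G B) = card X"
    unfolding HB.num_covered_components_eq unfolding B_def part(1)[OF X] ..
  let ?cyc = "{C \<in> ?N - X. ?n C = card C}" and ?path = "{C \<in> ?N - X. ?n C \<noteq> card C}"
  have pos: "C \<noteq> {} \<and> finite C" if "C \<in> blocks H" "fin_digraph H" for C :: "'a set" and H :: "('a, 'b) pre_digraph"
    using block_nonempty[OF that(1)] fin_digraph.finite_block[OF that(2,1)] by simp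
  have "linear_digraph (spanning_subgraph G A)"
    using lin by (rule linear_digraph_subset) (simp_all add: A)
  then have "num_directed_cycles (spanning_subgraph G A) =
      card {C \<in> blocks (spanning_subgraph G A). card (block_arcs (spanning_subgraph G A) C) = card C}"
    by (rule HA.num_directed_cycles_eq)
  also have "{C \<in> blocks (spanning_subgraph G A). card (block_arcs (spanning_subgraph G A) C) = card C}
      = {C \<in> nontrivial_blocks (spanning_subgraph G A). card (block_arcs (spanning_subgraph G A) C) = card C}"
    using pos[OF _ HA.fin_digraph_axioms] unfolding nontrivial_blocks_def
    by (metis (lifting) card.empty card_0_eq mem_Collect_eq)
  also have "\<dots> = ?cyc"
    unfolding A_def part(1)[OF Diff_subset] using part(2)[OF Diff_subset, of _ X] by auto
  finally have cyc: "num_directed_cycles (spanning_subgraph G A) = card ?cyc" .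
  have n1: "1 \<le> ?n C" if "C \<in> X" for C
    using that X fina[of C] by (auto simp: nontrivial_blocks_def Suc_le_eq card_gt_0_iff)
  have "card (blocks G) = card (blocks G - ?N) + card ?N"
    using card_Diff_subset[OF fin(2) N] card_mono[OF fin(1) N] by simp
  moreover have "card ?N = card X + card (?N - X)"
    using card_Diff_subset[OF fin(3) X] card_mono[OF fin(2) X] by simp
  moreover have "card (?N - X) = card ?cyc + card ?path"
    using fin(2) by (subst card_Un_disjoint[symmetric]) (auto intro!: arg_cong[where f = card])
  ultimately have xexp: "card (blocks G) - card X - card ?cyc = card (blocks G - ?N) + card ?path"
    by simp
  \<comment> \<open>Every component in \<open>X\<close> has an arc, so nothing is truncated when one
    is taken from each and \<open>card X\<close> is collected.\<close>
  have "(\<Sum>C\<in>X. ?n C) = (\<Sum>C\<in>X. ?n C - 1 + 1)"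
    by (rule sum.cong[OF refl]) (use n1 in force)
  also have "\<dots> = (\<Sum>C\<in>X. ?n C - 1) + card X"
    by (simp only: sum.distrib card_eq_sum)
  finally have yexp: "card A + card B - card X = (\<Sum>C\<in>X. ?n C - 1) + (\<Sum>C\<in>?N - X. ?n C)"
    using part(4)[OF X] part(4)[of "?N - X"] by (simp add: A_def B_def)
  have "(\<Prod>C\<in>X. y ^ (?n C - 1) * z) = y ^ (\<Sum>C\<in>X. ?n C - 1) * z ^ card X"
    by (simp add: prod.distrib power_sum)
  moreover have "(\<Prod>C\<in>?N - X. y ^ ?n C * (if ?n C = card C then 1 else x))
      = y ^ (\<Sum>C\<in>?N - X. ?n C) * x ^ card ?path"
  proof -
    have "(\<Prod>C\<in>?N - X. if ?n C = card C then 1 else x) = (\<Prod>C\<in>?path. x)"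
      using fin(4) by (intro prod.mono_neutral_cong_right) auto
    then show ?thesis by (simp add: prod.distrib power_sum)
  qed
  ultimately show ?thesis
    unfolding cov cyc num_components_eq xexp yexp by (simp add: power_add mult_ac)
qed

text \<open>Each component with arcs has a weight of two summands, one for its arcs going to
  \<open>B\<close> and one for \<open>A\<close>. Multiplying out chooses the set \<open>X\<close> of
  those that go to \<open>B\<close>.\<close>

lemma (in fin_digraph) weight_eq_sum:
  fixes x y z :: "'r::comm_ring_1"
  assumes lin: "linear_digraph G"
  shows "weight x y z G = (\<Sum>X\<in>Pow (nontrivial_blocks G).
    x ^ card (blocks G - nontrivial_blocks G) *
    ((\<Prod>C\<in>X. y ^ (card (block_arcs G C) - 1) * z) *
     (\<Prod>C\<in>nontrivial_blocks G - X.
        y ^ card (block_arcs G C) * (if card (block_arcs G C) = card C then 1 else x))))"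
proof -
  let ?N = "nontrivial_blocks G" and ?n = "\<lambda>C. card (block_arcs G C)"
  have N: "?N \<subseteq> blocks G" by (auto simp: nontrivial_blocks_def)
  have fin: "finite (blocks G)" "finite ?N"
    using finite_blocks N by (auto intro: finite_subset)
  have fina: "finite (block_arcs G C)" for C by (simp add: block_arcs_def)
  have "weight x y z G = (\<Prod>C\<in>blocks G - ?N. block_weight x y z (card C) (?n C)) *
      (\<Prod>C\<in>?N. block_weight x y z (card C) (?n C))"
    unfolding weight_def by (rule prod.subset_diff[OF N fin(1)])
  also have "(\<Prod>C\<in>blocks G - ?N. block_weight x y z (card C) (?n C)) = x ^ card (blocks G - ?N)"
    by (simp add: nontrivial_blocks_def block_weight_def)
  also have "(\<Prod>C\<in>?N. block_weight x y z (card C) (?n C)) =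
      (\<Prod>C\<in>?N. y ^ (?n C - 1) * z + y ^ ?n C * (if ?n C = card C then 1 else x))"
  proof (rule prod.cong[OF refl])
    fix C assume "C \<in> ?N"
    then have "?n C \<noteq> 0" using fina[of C] by (simp add: nontrivial_blocks_def)
    then obtain k where "?n C = Suc k" by (metis not0_implies_Suc)
    then show "block_weight x y z (card C) (?n C) =
        y ^ (?n C - 1) * z + y ^ ?n C * (if ?n C = card C then 1 else x)"
      by (simp add: block_weight_def algebra_simps)
  qed
  finally show ?thesis
    by (simp only: prod_add[OF fin(2)] sum_distrib_left)
qed

theorem theorem4p3:
  fixes D :: "('a, 'b) pre_digraph" and x y z :: "'r::comm_ring_1"
  assumes "fin_digraph D"
  shows "arc_elimination x y z D =
    (\<Sum>(A, B) \<in> admissible_pairs D.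
       x ^ (num_components (spanning_subgraph D (A \<union> B))
            - num_covered_components (spanning_subgraph D B)
            - num_directed_cycles (spanning_subgraph D A))
       * y ^ (card A + card B - num_covered_components (spanning_subgraph D B))
       * z ^ num_covered_components (spanning_subgraph D B))"
    (is "_ = (\<Sum>(A, B) \<in> admissible_pairs D. ?t A B)")
proof -
  interpret fin_digraph D by fact
  define H where "H F = spanning_subgraph D F" for F
  define U where "U F X = (\<Union>C\<in>X. block_arcs (H F) C)" for F X
  define N where "N F = nontrivial_blocks (H F)" for F
  have H: "fin_digraph (H F)" "linear_digraph (H F)" "F \<subseteq> arcs D" if "F \<in> linear_sets D" for F
    using that fin_digraph_spanning_subgraph by (auto simp: linear_sets_def H_def)
  have UF: "F = U F (N F)" if "F \<in> linear_sets D" for F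
    using wf_digraph.arcs_eq_Union_block_arcs[OF fin_digraph.axioms(1)[OF H(1)[OF that]]]
    by (simp add: U_def N_def H_def)
  have meet: "C = C'" if "C \<in> N F" "C' \<in> N F" "a \<in> block_arcs (H F) C" "a \<in> block_arcs (H F) C'"
    for F C C' a
    using that block_arcs_disjoint[of C "H F" C' a] by (simp add: N_def nontrivial_blocks_def)
  \<comment> \<open>\<open>X\<close> can be read off from the arc set it defines, because members of
    \<open>N F\<close> have arcs and different members share none.\<close>
  have UN: "{C \<in> N F. block_arcs (H F) C \<inter> U F X \<noteq> {}} = X" if "X \<subseteq> N F" for F X
  proof (intro equalityI subsetI)
    fix C assume "C \<in> {C \<in> N F. block_arcs (H F) C \<inter> U F X \<noteq> {}}"
    then show "C \<in> X" using meet that unfolding U_def by blast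
  next
    fix C assume "C \<in> X"
    then show "C \<in> {C \<in> N F. block_arcs (H F) C \<inter> U F X \<noteq> {}}"
      using that by (auto simp: N_def nontrivial_blocks_def U_def)
  qed
  have diff: "U F (N F - X) = F - U F X" if "F \<in> linear_sets D" "X \<subseteq> N F" for F X
  proof -
    have "U F (N F - X) \<inter> U F X = {}" using meet that(2) unfolding U_def by blast
    moreover have "U F (N F - X) \<union> U F X = F"
      using UF[OF that(1)] that(2) unfolding U_def by blast
    ultimately show ?thesis by blast
  qed
  have summand: "?t (F - U F X) (U F X) =
      x ^ card (blocks (H F) - N F) *
      ((\<Prod>C\<in>X. y ^ (card (block_arcs (H F) C) - 1) * z) *
       (\<Prod>C\<in>N F - X. y ^ card (block_arcs (H F) C) *
          (if card (block_arcs (H F) C) = card C then 1 else x)))"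
    if F: "F \<in> linear_sets D" and X: "X \<subseteq> N F" for F X
  proof -
    have "U F X \<subseteq> F" using UF[OF F] X unfolding U_def by blast
    then have un: "F - U F X \<union> U F X = F" by blast
    have "spanning_subgraph (H F) E = spanning_subgraph D E" for E
      by (simp add: H_def spanning_subgraph_def)
    from fin_digraph.admissible_summand_eq_prod[OF H(1,2)[OF F] X[unfolded N_def], of x y z,
        folded N_def U_def, unfolded diff[OF F X] this]
    show ?thesis unfolding un by (simp only: H_def)
  qed
  have recovered: "(\<lambda>(F, X). (F - U F X, U F X)) ((\<lambda>(A, B). (A \<union> B, {C \<in> N (A \<union> B). block_arcs (H (A \<union> B)) C \<inter> B \<noteq> {}})) p) = p"
      "(\<lambda>(A, B). (A \<union> B, {C \<in> N (A \<union> B). block_arcs (H (A \<union> B)) C \<inter> B \<noteq> {}})) p \<in> (SIGMA F:linear_sets D. Pow (N F))"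
    if p_in: "p \<in> admissible_pairs D" for p
  proof -
    obtain A B where p: "p = (A, B)" and AB: "A \<subseteq> arcs D" "B \<subseteq> arcs D" "A \<inter> B = {}"
      and apart: "\<And>a b. a \<in> A \<Longrightarrow> b \<in> B \<Longrightarrow> {tail D a, head D a} \<inter> {tail D b, head D b} = {}"
      and comps: "\<forall>K\<in>components (H (A \<union> B)). directed_cycle K \<or> directed_path K \<or> isolated_vertex K"
      using p_in by (auto simp: admissible_pairs_def H_def)
    let ?F = "A \<union> B" and ?X = "{C \<in> N (A \<union> B). block_arcs (H (A \<union> B)) C \<inter> B \<noteq> {}}"
    have F: "?F \<in> linear_sets D"
      using fin_digraph.linear_iff_components[OF fin_digraph_spanning_subgraph[of ?F]] AB comps
      by (simp add: linear_sets_def H_def)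
    \<comment> \<open>The vertices incident with \<open>B\<close>. No arc of \<open>A\<close>
      touches them, so an arc of \<open>A \<union> B\<close> has an end in \<open>V\<close> if and
      only if it belongs to \<open>B\<close>; a component with one arc in \<open>B\<close> therefore
      has all its arcs in \<open>B\<close>.\<close>
    define V where "V = tail D ` B \<union> head D ` B"
    have V: "tail D a \<in> V \<longleftrightarrow> a \<in> B" "head D a \<in> V \<longleftrightarrow> a \<in> B" if "a \<in> ?F" for a
      using that apart[of a] AB(3) unfolding V_def by blast+
    have whole: "block_arcs (H ?F) C \<subseteq> B" if C: "C \<in> N ?F" "b \<in> block_arcs (H ?F) C" "b \<in> B" for C b
    proof
      fix a assume a: "a \<in> block_arcs (H ?F) C"
      then have "a \<in> ?F" by (simp add: block_arcs_def H_def)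
      have "(tail D b, tail D a) \<in> conn (H ?F)"
        using conn_within_block[of C "H ?F"] C a by (simp add: N_def nontrivial_blocks_def block_arcs_def H_def)
      then have "tail D a \<in> V"
        by (induction rule: conn_induct) (use V C(3) in \<open>auto simp: V_def H_def\<close>)
      then show "a \<in> B" using V \<open>a \<in> ?F\<close> by blast
    qed
    have UX: "U ?F ?X = B"
    proof (intro equalityI subsetI)
      fix a assume "a \<in> U ?F ?X"
      then show "a \<in> B" using whole unfolding U_def by blast
    next
      fix b assume b: "b \<in> B"
      then have "b \<in> U ?F (N ?F)" using UF[OF F] by blast
      then show "b \<in> U ?F ?X" using b unfolding U_def by blast
    qed
    have "?F - B = A" using AB(3) by blast
    moreover have "(?F, ?X) \<in> (SIGMA F:linear_sets D. Pow (N F))" using F by blast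
    ultimately show
      "(\<lambda>(F, X). (F - U F X, U F X)) ((\<lambda>(A, B). (A \<union> B, {C \<in> N (A \<union> B). block_arcs (H (A \<union> B)) C \<inter> B \<noteq> {}})) p) = p"
      "(\<lambda>(A, B). (A \<union> B, {C \<in> N (A \<union> B). block_arcs (H (A \<union> B)) C \<inter> B \<noteq> {}})) p \<in> (SIGMA F:linear_sets D. Pow (N F))"
      by (simp_all add: p UX)
  qed
  have "arc_elimination x y z D = (\<Sum>F\<in>linear_sets D. weight x y z (H F))"
    unfolding arc_elimination_eq_linear_expansion[OF assms] linear_expansion_def H_def ..
  also have "\<dots> = (\<Sum>F\<in>linear_sets D. \<Sum>X\<in>Pow (N F). ?t (F - U F X) (U F X))"
    using summand fin_digraph.weight_eq_sum[OF H(1,2)]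
    by (intro sum.cong) (auto simp: N_def)
  also have "\<dots> = (\<Sum>(F, X)\<in>(SIGMA F:linear_sets D. Pow (N F)). ?t (F - U F X) (U F X))"
  proof (rule sum.Sigma)
    show "\<forall>F\<in>linear_sets D. finite (Pow (N F))"
      using fin_digraph.finite_blocks[OF H(1)]
      by (auto simp: N_def nontrivial_blocks_def)
  qed (rule finite_linear_sets)
  \<comment> \<open>Admissible pairs correspond to linear sets with a chosen set of components:
    \<open>B\<close> collects the arcs of the chosen components and \<open>A\<close> those of the
    others.\<close>
  also have "\<dots> = (\<Sum>(A, B) \<in> admissible_pairs D. ?t A B)"
  proof (rule sum.reindex_bij_witness[where
        i = "\<lambda>(A, B). (A \<union> B, {C \<in> N (A \<union> B). block_arcs (H (A \<union> B)) C \<inter> B \<noteq> {}})" and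
        j = "\<lambda>(F, X). (F - U F X, U F X)"], goal_cases)
    case (1 p)
    then obtain F X where p: "p = (F, X)" and F: "F \<in> linear_sets D" and X: "X \<subseteq> N F" by auto
    have "F - U F X \<union> U F X = F" using UF[OF F] X unfolding U_def by blast
    then show ?case using UN[OF X] by (simp add: p)
  next
    case (2 p)
    then obtain F X where p: "p = (F, X)" and F: "F \<in> linear_sets D" and X: "X \<subseteq> N F" by auto
    have sub: "U F X \<subseteq> F" using UF[OF F] X unfolding U_def by blast
    then have un: "F - U F X \<union> U F X = F" by blast
    have ends: "tail D a \<in> C \<and> head D a \<in> C" if "C \<in> N F" "a \<in> block_arcs (H F) C" for C a
      using that saturated_block[of C "H F"]
      by (auto simp: N_def nontrivial_blocks_def saturated_def block_arcs_def H_def)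
    have "{tail D a, head D a} \<inter> {tail D b, head D b} = {}"
      if ab: "a \<in> F - U F X" "b \<in> U F X" for a b
    proof -
      obtain C where C: "C \<in> N F - X" "a \<in> block_arcs (H F) C"
        using ab(1)[folded diff[OF F X]] unfolding U_def by blast
      obtain C' where C': "C' \<in> X" "b \<in> block_arcs (H F) C'"
        using ab(2) unfolding U_def by blast
      \<comment> \<open>Arcs on opposite sides lie in different blocks, and blocks are disjoint;
        this yields the condition that no vertex is incident with both sets.\<close>
      have "C \<inter> C' = {}"
        using C(1) C'(1) X blocks_disjoint[of C "H F" C'] by (auto simp: N_def nontrivial_blocks_def)
      moreover have "tail D a \<in> C \<and> head D a \<in> C" "tail D b \<in> C' \<and> head D b \<in> C'"
        using ends[of C a] ends[of C' b] C C' X by blast+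
      ultimately show ?thesis unfolding disjoint_iff by (metis empty_iff insert_iff)
    qed
    moreover have "\<forall>K\<in>components (H F). directed_cycle K \<or> directed_path K \<or> isolated_vertex K"
      using fin_digraph.linear_iff_components[OF H(1)[OF F]] H(2)[OF F] by blast
    ultimately show ?case
      using H(3)[OF F] sub un by (auto simp: p admissible_pairs_def H_def)
  next
    case (3 p)
    then show ?case by (rule recovered)
  next
    case (4 p)
    then show ?case by (rule recovered)
  qed auto
  finally show ?thesis .
qed

end
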